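(* Let $\{\mathbf z_1,\dots,\mathbf z_s\}\subseteq S_{\mathbf w}$ be a finite point set that is unisolvent for $\mathcal V$, let $\alpha_1,\dots,\alpha_s>0$, and let $\mathbf M=\sum_{i=1}^s\alpha_i\,\mathbf q(\mathbf z_i)\mathbf q(\mathbf z_i)^{\mathrm T}$. Let $\mathbf e\in\Sigma^\circ$ and $$k_1^{\mathbf e}=\min\{\mathbf e^{\mathrm T}\mathbf v \mid \mathbf v\in\Sigma^*,\ \|\mathbf v\|_\infty=1\}.$$ Let $\nu=\sum_{i=1}^m L_i$, let $\mathbf t\in\Sigma^\circ$, and let $\varepsilon>0$ be such that $\mathbf t-\varepsilon\mathbf e$ lies on the boundary of $\Sigma$. Then there exists a dual certificate $\overline{\mathbf y}\in\mathbb Z^U$ of $\mathbf t$ with $$\|\overline{\mathbf y}\|_\infty\le\frac12+\left\lceil\frac32\sqrt{U\operatorname{cond}(\mathbf M)}\,\|\mathbf t\|_2\right\rceil\frac{\nu}{k_1^{\mathbf e}\,\varepsilon}.$$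
   Context: Fix $n\ge1$, nonzero polynomials $\mathbf w=(w_1,\dots,w_m)$ in $\mathbb R[z_1,\dots,z_n]$ and nonnegative integers $\mathbf d=(d_1,\dots,d_m)$. $\mathcal V_{n,k}$ is the space of real $n$-variate polynomials of degree at most $k$; $\Sigma_{n,2k}$ is the cone of sums of squares of elements of $\mathcal V_{n,k}$. Let $\mathcal V=\{\sum_i w_ir_i: r_i\in\mathcal V_{n,2d_i}\}$, $U=\dim\mathcal V$, and $\Sigma=\{\sum_i w_i\sigma_i:\sigma_i\in\Sigma_{n,2d_i}\}\subseteq\mathcal V$ (weighted sums of squares). Let $S_{\mathbf w}=\{\mathbf z\in\mathbb R^n: w_i(\mathbf z)\ge0,\ i=1,\dots,m\}$. Fix an ordered basis $\mathbf q=(q_1,\dots,q_U)$ of $\mathcal V$ and ordered bases $\mathbf p_i$ of $\mathcal V_{n,d_i}$, $L_i=\dim\mathcal V_{n,d_i}$. Polynomials in $\mathcal V$ are identified with their coefficient vectors in the basis $\mathbf q$, so $\Sigma\subseteq\mathbb R^U$; $\Sigma^*=\{\mathbf y\in\mathbb R^U:\mathbf x^{\mathrm T}\mathbf y\ge0\ \forall\mathbf x\in\Sigma\}$. $\Lambda_i:\mathbb R^U\to\mathbb S^{L_i}$ is the unique linear map to symmetric matrices with $\Lambda_i(\mathbf q(\mathbf z))=w_i(\mathbf z)\mathbf p_i(\mathbf z)\mathbf p_i(\mathbf z)^{\mathrm T}$ for all $\mathbf z$, and $\Lambda=\Lambda_1\oplus\cdots\oplus\Lambda_m$ (block diagonal).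 Standing assumption: $\Sigma$ is closed and pointed, so $\Sigma$ and $\Sigma^*$ are closed, pointed cones with nonempty interiors $\Sigma^\circ,(\Sigma^* )^\circ$, and $\Sigma^*=\{\mathbf x:\Lambda(\mathbf x)\succcurlyeq0\}$, $(\Sigma^* )^\circ=\{\mathbf x:\Lambda(\mathbf x)\succ0\}$. Barrier function: $f(\mathbf x)=-\ln\det\Lambda(\mathbf x)$ on $(\Sigma^* )^\circ$, with gradient $g$ and (positive definite) Hessian $H$. A vector $\mathbf x\in(\Sigma^* )^\circ$ is a dual certificate of $\mathbf s\in\Sigma$ (it certifies $\mathbf s$) if $H(\mathbf x)^{-1}\mathbf s\in\Sigma^*$. A set $S$ is unisolvent for $\mathcal V$ if every polynomial in $\mathcal V$ is uniquely determined by its values on $S$. $\operatorname{cond}(\mathbf M)=\lambda_{\max}(\mathbf M)/\lambda_{\min}(\mathbf M)$. *)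

theory Defs
  imports "HOL-Analysis.Analysis" "HOL-Library.Poly_Mapping"
begin

section \<open>Real multivariate polynomials\<close>

text \<open>A monomial is an exponent vector indexed by the finite type of variables, and a polynomial
  maps monomials to coefficients with finite support. Sums and products are those of the type
  \<^typ>\<open>'a \<Rightarrow>\<^sub>0 'b\<close>; only the real vector space structure has to be added.\<close>

type_synonym 'n rpoly = "('n \<Rightarrow>\<^sub>0 nat) \<Rightarrow>\<^sub>0 real"

instantiation poly_mapping :: (type, real_vector) real_vector
begin

lift_definition scaleR_poly_mapping :: "real \<Rightarrow> ('a \<Rightarrow>\<^sub>0 'b) \<Rightarrow> 'a \<Rightarrow>\<^sub>0 'b"
  is "\<lambda>c f k. c *\<^sub>R f k"
  by (erule rev_finite_subset) auto

instance
  by standard (transfer; simp add: fun_eq_iff scaleR_add_right scaleR_add_left)+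

end

definition eval :: "'n::finite rpoly \<Rightarrow> real ^ 'n \<Rightarrow> real" where
  "eval p z = (\<Sum>m\<in>Poly_Mapping.keys p.
     Poly_Mapping.lookup p m * (\<Prod>i\<in>UNIV. (z $ i) ^ Poly_Mapping.lookup m i))"

definition polys_le :: "nat \<Rightarrow> 'n::finite rpoly set" where
  "polys_le k = {p. \<forall>m\<in>Poly_Mapping.keys p. (\<Sum>i\<in>UNIV. Poly_Mapping.lookup m i) \<le> k}"

text \<open>Sums of squares of polynomials of degree at most \<open>k\<close>, that is, the cone written with index
  \<open>2k\<close> in the literature.\<close>

definition sos :: "nat \<Rightarrow> 'n::finite rpoly set" where
  "sos k = {\<Sum>r\<leftarrow>rs. r ^ 2 | rs. set rs \<subseteq> polys_le k}"

definition ordered_basis_on :: "'i set \<Rightarrow> ('i \<Rightarrow> 'v::real_vector) \<Rightarrow> 'v set \<Rightarrow> bool" where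
  "ordered_basis_on I b W \<longleftrightarrow> inj_on b I \<and> independent (b ` I) \<and> span (b ` I) = W"

definition unisolvent :: "(real ^ 'n::finite) set \<Rightarrow> 'n rpoly set \<Rightarrow> bool" where
  "unisolvent S W \<longleftrightarrow> (\<forall>p\<in>W. \<forall>r\<in>W. (\<forall>z\<in>S. eval p z = eval r z) \<longrightarrow> p = r)"

section \<open>Weighted sums of squares\<close>

definition weighted_space :: "('m::finite \<Rightarrow> 'n::finite rpoly) \<Rightarrow> ('m \<Rightarrow> nat) \<Rightarrow> 'n rpoly set" where
  "weighted_space w d = {\<Sum>i\<in>UNIV. w i * r i | r. \<forall>i. r i \<in> polys_le (2 * d i)}"

definition weighted_sos :: "('m::finite \<Rightarrow> 'n::finite rpoly) \<Rightarrow> ('m \<Rightarrow> nat) \<Rightarrow> 'n rpoly set" where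
  "weighted_sos w d = {\<Sum>i\<in>UNIV. w i * \<sigma> i | \<sigma>. \<forall>i. \<sigma> i \<in> sos (d i)}"

definition semialg :: "('m \<Rightarrow> 'n::finite rpoly) \<Rightarrow> (real ^ 'n) set" where
  "semialg w = {z. \<forall>i. eval (w i) z \<ge> 0}"

definition eval_vec :: "('u::finite \<Rightarrow> 'n::finite rpoly) \<Rightarrow> real ^ 'n \<Rightarrow> real ^ 'u" where
  "eval_vec q z = (\<chi> j. eval (q j) z)"

text \<open>The weighted sum-of-squares cone as a set of coefficient vectors in the basis \<open>q\<close>.\<close>

definition Sig :: "('m::finite \<Rightarrow> 'n::finite rpoly) \<Rightarrow> ('m \<Rightarrow> nat) \<Rightarrow> ('u::finite \<Rightarrow> 'n rpoly)
    \<Rightarrow> (real ^ 'u) set" where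
  "Sig w d q = {s. (\<Sum>j\<in>UNIV. (s $ j) *\<^sub>R q j) \<in> weighted_sos w d}"

definition dual_cone :: "'a::real_inner set \<Rightarrow> 'a set" where
  "dual_cone C = {y. \<forall>x\<in>C. x \<bullet> y \<ge> 0}"

definition pointed :: "'a::real_vector set \<Rightarrow> bool" where
  "pointed C \<longleftrightarrow> C \<inter> uminus ` C = {0}"

section \<open>The barrier function and dual certificates\<close>

text \<open>The bases \<open>p\<^sub>i\<close> of the spaces of polynomials of degree at most \<open>d i\<close> have different
  lengths \<open>L\<^sub>i\<close>. They are given by one family \<open>p\<close>, indexed by a type \<open>'l\<close> with
  \<open>\<nu> = \<Sum>\<^sub>i L\<^sub>i\<close> elements, and a map \<open>blk :: 'l \<Rightarrow> 'm\<close> whose fibre over \<open>i\<close> is the index set of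
  \<open>p\<^sub>i\<close>. Thus \<open>real ^ 'l ^ 'l\<close> is the space of \<open>\<nu> \<times> \<nu>\<close> matrices, cut into blocks by \<open>blk\<close>, and
  \<open>Lambda_block i\<close> is \<open>\<Lambda>\<^sub>i\<close> placed in the \<open>i\<close>-th diagonal block and padded by zeros, so
  that the direct sum of the \<open>\<Lambda>\<^sub>i\<close> becomes an ordinary sum.\<close>

definition Lambda_block :: "('m::finite \<Rightarrow> 'n::finite rpoly) \<Rightarrow> ('u::finite \<Rightarrow> 'n rpoly)
    \<Rightarrow> ('l::finite \<Rightarrow> 'm) \<Rightarrow> ('l \<Rightarrow> 'n rpoly) \<Rightarrow> 'm \<Rightarrow> real ^ 'u \<Rightarrow> real ^ 'l ^ 'l" where
  "Lambda_block w q blk p i = (THE L. linear L \<and>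
     (\<forall>z. L (eval_vec q z) =
       (\<chi> a b. if blk a = i \<and> blk b = i then eval (w i) z * eval (p a) z * eval (p b) z else 0)))"

definition Lambda :: "('m::finite \<Rightarrow> 'n::finite rpoly) \<Rightarrow> ('u::finite \<Rightarrow> 'n rpoly)
    \<Rightarrow> ('l::finite \<Rightarrow> 'm) \<Rightarrow> ('l \<Rightarrow> 'n rpoly) \<Rightarrow> real ^ 'u \<Rightarrow> real ^ 'l ^ 'l" where
  "Lambda w q blk p x = (\<Sum>i\<in>UNIV. Lambda_block w q blk p i x)"

text \<open>The barrier is only meaningful on the interior of the dual cone. As this set is open, the
  derivatives below do not depend on the values taken outside it.\<close>

definition barrier :: "('m::finite \<Rightarrow> 'n::finite rpoly) \<Rightarrow> ('u::finite \<Rightarrow> 'n rpoly)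
    \<Rightarrow> ('l::finite \<Rightarrow> 'm) \<Rightarrow> ('l \<Rightarrow> 'n rpoly) \<Rightarrow> real ^ 'u \<Rightarrow> real" where
  "barrier w q blk p x = - ln (det (Lambda w q blk p x))"

definition gradient :: "('a::real_inner \<Rightarrow> real) \<Rightarrow> 'a \<Rightarrow> 'a" where
  "gradient f x = (THE D. GDERIV f x :> D)"

definition hessian :: "(real ^ 'u::finite \<Rightarrow> real) \<Rightarrow> real ^ 'u \<Rightarrow> real ^ 'u ^ 'u" where
  "hessian f x = jacobian (gradient f) (at x)"

definition dual_certificate :: "('m::finite \<Rightarrow> 'n::finite rpoly) \<Rightarrow> ('m \<Rightarrow> nat)
    \<Rightarrow> ('u::finite \<Rightarrow> 'n rpoly) \<Rightarrow> ('l::finite \<Rightarrow> 'm) \<Rightarrow> ('l \<Rightarrow> 'n rpoly)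
    \<Rightarrow> real ^ 'u \<Rightarrow> real ^ 'u \<Rightarrow> bool" where
  "dual_certificate w d q blk p x s \<longleftrightarrow>
     s \<in> Sig w d q \<and> x \<in> interior (dual_cone (Sig w d q)) \<and>
     matrix_inv (hessian (barrier w q blk p) x) *v s \<in> dual_cone (Sig w d q)"

section \<open>The constants in the bound\<close>

text \<open>The condition number is only used for symmetric matrices, whose set of real eigenvalues is
  finite and nonempty.\<close>

definition eigenvalues :: "real ^ 'u ^ 'u::finite \<Rightarrow> real set" where
  "eigenvalues M = {c. \<exists>v. v \<noteq> 0 \<and> M *v v = c *\<^sub>R v}"

definition cond :: "real ^ 'u ^ 'u::finite \<Rightarrow> real" where
  "cond M = Max (eigenvalues M) / Min (eigenvalues M)"

definition outer :: "real ^ 'u \<Rightarrow> real ^ 'u ^ 'u::finite" where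
  "outer v = (\<chi> j k. v $ j * v $ k)"

text \<open>\<open>LEAST\<close> on the reals is the minimum of the set of values (here it is attained).\<close>

definition k1 :: "(real ^ 'u::finite) set \<Rightarrow> real ^ 'u \<Rightarrow> real" where
  "k1 C e = (LEAST c. \<exists>v\<in>dual_cone C. infnorm v = 1 \<and> c = e \<bullet> v)"

end

theory Submission
  imports Defs "HOL-Computational_Algebra.Polynomial"
begin

text \<open>The maximiser \<open>y\<close> of \<open>det (\<Lambda> x)\<close> on the compact slice \<open>t \<bullet> x = \<nu>\<close> of the cone \<open>\<Lambda> x \<succeq> 0\<close>
  satisfies \<open>tr (\<Lambda>(y)\<inverse> \<Lambda>(v)) = t \<bullet> v\<close> for all \<open>v\<close>, that is, \<open>- g(y) = t\<close>. In particular
  \<open>t \<bullet> y = \<nu>\<close>, so \<open>e \<bullet> y \<le> \<nu> / \<epsilon>\<close>, because \<open>t - \<epsilon> e\<close> lies in the closed cone \<open>\<Sigma>\<close>; this bounds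
  \<open>y\<close> in the maximum norm. Every \<open>x\<close> in the open unit ball around \<open>y\<close> of the local norm
  \<open>\<parallel>v\<parallel>\<^sub>y\<^sup>2 = tr (\<Lambda>(y)\<inverse> \<Lambda>(v) \<Lambda>(y)\<inverse> \<Lambda>(v))\<close> certifies \<open>t\<close>. Writing \<open>v\<close> as a combination of the
  vectors \<open>q(z\<^sub>i)\<close> by means of \<open>M\<inverse>\<close>, on which \<open>\<Lambda>\<close> is positive semidefinite, gives
  \<open>\<parallel>v\<parallel>\<^sub>y \<le> sqrt (cond M) \<parallel>t\<parallel> \<parallel>v\<parallel>\<close>. Replacing \<open>t\<close> by \<open>t / N\<close> scales \<open>y\<close> by \<open>N\<close> and the local norm by
  \<open>1 / N\<close>, so for \<open>N = \<lceil>3/2 sqrt (U cond M) \<parallel>t\<parallel>\<rceil>\<close> rounding \<open>N y\<close> to the nearest integer vector moves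
  it by at most \<open>1/3\<close> in the local norm.\<close>

section \<open>Polynomial functions\<close>

lemma eval_eq_sum_superset:
  assumes "finite A" "Poly_Mapping.keys p \<subseteq> A"
  shows "eval p z =
    (\<Sum>m\<in>A. Poly_Mapping.lookup p m * (\<Prod>i\<in>UNIV. (z $ i) ^ Poly_Mapping.lookup m i))"
  unfolding eval_def using assms by (intro sum.mono_neutral_left) (auto simp: in_keys_iff)

lemma lookup_scaleR [simp]: "Poly_Mapping.lookup (c *\<^sub>R p) m = c *\<^sub>R Poly_Mapping.lookup p m"
  by transfer simp

lemma keys_scaleR: "Poly_Mapping.keys (c *\<^sub>R p) \<subseteq> Poly_Mapping.keys p"
  by (auto simp: in_keys_iff)

lemma eval_add: "eval (p + r) z = eval p z + eval r z"
proof -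
  let ?A = "Poly_Mapping.keys p \<union> Poly_Mapping.keys r"
  have "Poly_Mapping.keys (p + r) \<subseteq> ?A" by (rule Poly_Mapping.keys_add)
  then show ?thesis
    by (simp add: eval_eq_sum_superset[of ?A] lookup_add distrib_right sum.distrib)
qed

lemma eval_scaleR: "eval (c *\<^sub>R p) z = c * eval p z"
  using eval_eq_sum_superset[OF finite_keys keys_scaleR]
  by (simp add: eval_def sum_distrib_left mult.assoc)

lemma eval_0 [simp]: "eval 0 z = 0"
  by (simp add: eval_def)

lemma eval_sum: "eval (\<Sum>i\<in>I. f i) z = (\<Sum>i\<in>I. eval (f i) z)"
  by (induction I rule: infinite_finite_induct) (simp_all add: eval_add)

lemma eval_single:
  "eval (Poly_Mapping.single m c) z = c * (\<Prod>i\<in>UNIV. (z $ i) ^ Poly_Mapping.lookup m i)"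
  by (simp add: eval_def)

lemma eval_mult_single: "eval (Poly_Mapping.single m a * Poly_Mapping.single m' b) z
    = eval (Poly_Mapping.single m a) z * eval (Poly_Mapping.single m' b) z"
  by (simp add: mult_single eval_single lookup_add power_add prod.distrib)

lemma sum_single_keys:
  "(\<Sum>m\<in>Poly_Mapping.keys p. Poly_Mapping.single m (Poly_Mapping.lookup p m)) = p"
  by (rule poly_mapping_eqI)
    (simp add: lookup_sum lookup_single when_def in_keys_iff)

lemma eval_mult: "eval (p * r) z = eval p z * eval r z"
proof -
  let ?s = "\<lambda>p m. Poly_Mapping.single m (Poly_Mapping.lookup p m)"
  have "p * r = (\<Sum>m\<in>Poly_Mapping.keys p. \<Sum>m'\<in>Poly_Mapping.keys r. ?s p m * ?s r m')"
    by (simp add: sum_single_keys flip: sum_product)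
  then have "eval (p * r) z
      = (\<Sum>m\<in>Poly_Mapping.keys p. \<Sum>m'\<in>Poly_Mapping.keys r. eval (?s p m) z * eval (?s r m') z)"
    by (simp add: eval_sum eval_mult_single)
  also have "\<dots> = eval (\<Sum>m\<in>Poly_Mapping.keys p. ?s p m) z * eval (\<Sum>m\<in>Poly_Mapping.keys r. ?s r m) z"
    by (simp add: eval_sum sum_product)
  finally show ?thesis by (simp add: sum_single_keys)
qed

text \<open>Dedekind's argument: monomials are distinct multiplicative characters.\<close>

lemma monomials_independent:
  fixes c :: "('n::finite \<Rightarrow>\<^sub>0 nat) \<Rightarrow> real"
  assumes "finite A" and "\<And>z :: real ^ 'n. (\<Sum>m\<in>A. c m * (\<Prod>i\<in>UNIV. (z $ i) ^ Poly_Mapping.lookup m i)) = 0"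
  shows "\<forall>m\<in>A. c m = 0"
  using assms
proof (induction A arbitrary: c rule: finite_induct)
  case (insert a A)
  define mon where "mon m z = (\<Prod>i\<in>UNIV. (z $ i) ^ Poly_Mapping.lookup m i)"
    for m :: "'n \<Rightarrow>\<^sub>0 nat" and z :: "real ^ 'n"
  have mon_mult: "mon m (\<chi> i. x $ i * y $ i) = mon m x * mon m y" for m x y
    by (simp add: mon_def power_mult_distrib prod.distrib)
  have rel: "c a * mon a z + (\<Sum>m\<in>A. c m * mon m z) = 0" for z
    using insert.prems[of z] insert.hyps by (simp add: mon_def)
  \<comment> \<open>Subtracting \<open>mon a y\<close> times the relation at \<open>z\<close> from
    the relation at the componentwise product of \<open>y\<close> and \<open>z\<close> cancels the
    term of \<open>a\<close>.\<close>
  have "(\<Sum>m\<in>A. (c m * (mon m y - mon a y)) * mon m z) = 0" for y z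
    using rel[of "\<chi> i. y $ i * z $ i"] arg_cong[OF rel[of z], of "\<lambda>r. mon a y * r"]
    by (simp add: mon_mult right_diff_distrib left_diff_distrib sum_subtractf sum_distrib_left
        distrib_left mult_ac)
  then have "\<forall>m\<in>A. c m * (mon m y - mon a y) = 0" for y
    unfolding mon_def by (intro insert.IH) auto
  moreover have "\<exists>y. mon m y \<noteq> mon a y" if "m \<in> A" for m
  proof -
    have "m \<noteq> a" using that insert.hyps by blast
    then obtain k where k: "Poly_Mapping.lookup m k \<noteq> Poly_Mapping.lookup a k"
      by (metis poly_mapping_eqI)
    \<comment> \<open>The value 2 in coordinate \<open>k\<close> and 1 elsewhere exposes the
      exponent of \<open>k\<close> as a power of 2.\<close>
    have "mon n (\<chi> i. if i = k then 2 else 1) = 2 ^ Poly_Mapping.lookup n k" for n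
      unfolding mon_def by (subst prod.remove[of _ k]) (auto intro!: prod.neutral)
    then show ?thesis
      using k by (intro exI[of _ "\<chi> i. if i = k then 2 else 1"]) (simp add: power_inject_exp)
  qed
  ultimately have zero: "\<forall>m\<in>A. c m = 0"
    by (metis eq_iff_diff_eq_0 mult_eq_0_iff)
  have "mon a (\<chi> i. 1) = 1" by (simp add: mon_def)
  then have "c a = 0" using rel[of "\<chi> i. 1"] zero by simp
  with zero show ?case by simp
qed simp

lemma eval_eq_zero_imp_zero:
  assumes "\<And>z. eval p z = 0"
  shows "p = 0"
proof -
  have "\<forall>m\<in>Poly_Mapping.keys p. Poly_Mapping.lookup p m = 0"
    using assms by (intro monomials_independent) (auto simp: eval_def)
  then show ?thesis by (intro poly_mapping_eqI) (auto simp: in_keys_iff)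
qed

text \<open>Restriction to a line passes to univariate polynomials, which have no zero
  divisors.\<close>

lemma eval_on_line:
  fixes p :: "'n::finite rpoly"
  obtains P where "\<And>s. eval p (a + s *\<^sub>R b) = poly P s"
proof
  show "eval p (a + s *\<^sub>R b) = poly (\<Sum>m\<in>Poly_Mapping.keys p. Polynomial.smult (Poly_Mapping.lookup p m)
      (\<Prod>i\<in>UNIV. [:a $ i, b $ i:] ^ Poly_Mapping.lookup m i)) s" for s
    by (simp add: eval_def poly_sum poly_prod)
qed

text \<open>The line is taken through a point where \<open>p\<close> is nonzero and a point where
  \<open>r\<close> would be nonzero. Neither restriction to it is zero, yet their product vanishes
  at every real number.\<close>

lemma eval_mult_eq_zero:
  assumes "\<And>z. eval p z * eval r z = 0" and "p \<noteq> 0"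
  shows "r = 0"
proof (rule ccontr)
  assume "r \<noteq> 0"
  obtain a where a: "eval p a \<noteq> 0" using \<open>p \<noteq> 0\<close> eval_eq_zero_imp_zero by blast
  obtain b where b: "eval r b \<noteq> 0" using \<open>r \<noteq> 0\<close> eval_eq_zero_imp_zero by blast
  obtain P where P: "\<And>s. eval p (a + s *\<^sub>R (b - a)) = poly P s" using eval_on_line by blast
  obtain R where R: "\<And>s. eval r (a + s *\<^sub>R (b - a)) = poly R s" using eval_on_line by blast
  have "poly (P * R) s = 0" for s using assms(1) by (simp flip: P R)
  then have "P * R = 0" using poly_all_0_iff_0 by blast
  moreover have "P \<noteq> 0" using P[of 0] a by auto
  moreover have "R \<noteq> 0" using R[of 1] b by auto
  ultimately show False by simp
qed

section \<open>Degree bounds and coordinates in ordered bases\<close>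

lemma polys_le_0 [simp]: "0 \<in> polys_le k"
  by (simp add: polys_le_def)

lemma polys_le_mult:
  assumes "p \<in> polys_le j" "r \<in> polys_le k"
  shows "p * r \<in> polys_le (j + k)"
proof -
  have "(\<Sum>i\<in>UNIV. Poly_Mapping.lookup m i) \<le> j + k" if "m \<in> Poly_Mapping.keys (p * r)" for m
  proof -
    obtain a b where "m = a + b" "a \<in> Poly_Mapping.keys p" "b \<in> Poly_Mapping.keys r"
      using \<open>m \<in> _\<close> keys_mult[of p r] by blast
    then show ?thesis
      using assms by (auto simp: polys_le_def lookup_add sum.distrib intro!: add_mono)
  qed
  then show ?thesis by (simp add: polys_le_def)
qed

text \<open>The entries of \<Lambda>_i come from such products, and so do the weighted squares to
  which unisolvence is applied.\<close>

lemma weighted_space_mult: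
  assumes "r \<in> polys_le (d i)" "r' \<in> polys_le (d i)"
  shows "w i * (r * r') \<in> weighted_space w d"
proof -
  have "r * r' \<in> polys_le (2 * d i)" using polys_le_mult[OF assms] by (simp add: mult_2)
  then have "\<forall>j. (if j = i then r * r' else 0) \<in> polys_le (2 * d j)" by simp
  moreover have "(\<Sum>j\<in>UNIV. w j * (if j = i then r * r' else 0)) = w i * (r * r')"
    by (subst sum.remove[of _ i]) auto
  ultimately show ?thesis
    unfolding weighted_space_def by (intro CollectI exI[of _ "\<lambda>j. if j = i then r * r' else 0"]) simp
qed

lemma ordered_basis_sum_eq_0:
  assumes "ordered_basis_on I b W" "finite I" "(\<Sum>i\<in>I. c i *\<^sub>R b i) = 0" "i \<in> I"
  shows "c i = 0"
proof -
  have inj: "inj_on b I" and ind: "independent (b ` I)"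
    using assms(1) by (auto simp: ordered_basis_on_def)
  \<comment> \<open>Independence is a property of the image set, so the indexed sum is moved there
    along the injection \<open>b\<close>.\<close>
  have "(\<Sum>x\<in>b ` I. c (the_inv_into I b x) *\<^sub>R x) = 0"
    using assms(3) by (simp add: sum.reindex[OF inj] the_inv_into_f_f[OF inj] cong: sum.cong)
  then have "c (the_inv_into I b (b i)) = 0"
    using assms(2,4) by (intro independentD[OF ind _ subset_refl]) auto
  then show ?thesis using inj assms(4) by (simp add: the_inv_into_f_f)
qed

lemma ordered_basis_coordinates:
  assumes "ordered_basis_on I b W" "finite I" "x \<in> W"
  obtains c where "x = (\<Sum>i\<in>I. c i *\<^sub>R b i)"
proof -
  have inj: "inj_on b I" and "x \<in> span (b ` I)"
    using assms by (auto simp: ordered_basis_on_def)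
  then obtain u where "x = (\<Sum>v\<in>b ` I. u v *\<^sub>R v)"
    using assms(2) by (auto simp: span_finite)
  then show thesis using that[of "u \<circ> b"] by (simp add: sum.reindex[OF inj])
qed

lemma ordered_basis_dim:
  assumes "ordered_basis_on I b W"
  shows "dim W = card I"
  using assms unfolding ordered_basis_on_def
  by (metis card_image dim_eq_card_independent dim_span)

lemma ordered_basis_subset: "ordered_basis_on I b W \<Longrightarrow> i \<in> I \<Longrightarrow> b i \<in> W"
  unfolding ordered_basis_on_def by (blast intro: span_base)

section \<open>Positive semidefinite matrices\<close>

definition psd :: "real ^ 'n ^ 'n::finite \<Rightarrow> bool" where
  "psd A \<longleftrightarrow> transpose A = A \<and> (\<forall>h. 0 \<le> h \<bullet> (A *v h))"

definition pd :: "real ^ 'n ^ 'n::finite \<Rightarrow> bool" where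
  "pd A \<longleftrightarrow> transpose A = A \<and> (\<forall>h. h \<noteq> 0 \<longrightarrow> 0 < h \<bullet> (A *v h))"

lemma pd_imp_psd: "pd A \<Longrightarrow> psd A"
  unfolding pd_def psd_def by (metis inner_zero_left order_less_imp_le order_refl)

lemma symmetric_dot: "transpose A = A \<Longrightarrow> x \<bullet> (A *v y) = (A *v x) \<bullet> y"
  for A :: "real ^ 'n ^ 'n::finite"
  by (metis dot_lmul_matrix vector_transpose_matrix)

lemma outer_mult_vector: "outer u *v x = (u \<bullet> x) *\<^sub>R u"
  by (simp add: vec_eq_iff outer_def matrix_vector_mult_def inner_vec_def sum_distrib_left
      mult_ac)

lemma transpose_outer [simp]: "transpose (outer u) = outer u"
  by (simp add: vec_eq_iff outer_def transpose_def mult.commute)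

lemma sum_matrix_vector_mult: "(\<Sum>i\<in>I. A i) *v x = (\<Sum>i\<in>I. A i *v x)"
  for A :: "'i \<Rightarrow> real ^ 'm ^ 'n::finite"
  by (induction I rule: infinite_finite_induct) (auto simp: matrix_vector_mult_add_rdistrib)

lemma transpose_add: "transpose (A + B) = transpose A + transpose B"
  for A :: "real ^ 'm ^ 'n"
  by (simp add: vec_eq_iff transpose_def)

lemma transpose_sum: "transpose (\<Sum>i\<in>I. A i) = (\<Sum>i\<in>I. transpose (A i))"
  by (simp add: vec_eq_iff transpose_def)

lemma transpose_scaleR: "transpose (c *\<^sub>R A) = c *\<^sub>R transpose A"
  by (simp add: vec_eq_iff transpose_def)

lemma sum_scaleR_axis: "(\<Sum>j\<in>UNIV. v $ j *\<^sub>R axis j 1) = v"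
  for v :: "real ^ 'n::finite"
  using basis_expansion[of v] by (simp only: scalar_mult_eq_scaleR)

lemma pd_scaleR: "pd A \<Longrightarrow> 0 < c \<Longrightarrow> pd (c *\<^sub>R A)"
  by (simp add: pd_def transpose_scaleR flip: scaleR_matrix_vector_assoc)

text \<open>The form is nonnegative on the plane spanned by \<open>u\<close> and \<open>v\<close>,
  which forces its discriminant to be nonpositive.\<close>

lemma psd_cauchy_schwarz:
  assumes "psd A"
  shows "(u \<bullet> (A *v v))\<^sup>2 \<le> (u \<bullet> (A *v u)) * (v \<bullet> (A *v v))"
proof -
  have sym: "transpose A = A" and nonneg: "\<And>h. 0 \<le> h \<bullet> (A *v h)"
    using assms by (auto simp: psd_def)
  define a b c where "a = u \<bullet> (A *v u)" and "b = u \<bullet> (A *v v)" and "c = v \<bullet> (A *v v)"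
  have vu: "v \<bullet> (A *v u) = b"
    unfolding b_def using symmetric_dot[OF sym, of v u] by (simp add: inner_commute)
  have quad: "0 \<le> a * x\<^sup>2 + 2 * b * x * y + c * y\<^sup>2" for x y
    using nonneg[of "x *\<^sub>R u + y *\<^sub>R v"] vu
    by (simp add: a_def b_def c_def matrix_vector_mult_scaleR matrix_vector_right_distrib
        inner_add_left inner_add_right algebra_simps power2_eq_square)
  have "a \<ge> 0" "c \<ge> 0" using nonneg by (simp_all add: a_def c_def)
  have "b\<^sup>2 \<le> a * c"
  proof (cases "a = 0")
    case True
    have "b = 0"
    proof (rule ccontr)
      assume "b \<noteq> 0"
      \<comment> \<open>For \<open>a = 0\<close> this point gives the form the value -1.\<close>
      with quad[of "- (c + 1) / (2 * b)" 1] True show False by (simp add: field_simps)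
    qed
    then show ?thesis using True by simp
  next
    case False
    \<comment> \<open>The point with coordinates \<open>b\<close> and \<open>- a\<close> gives the
      form exactly this value.\<close>
    have "a * (a * c - b\<^sup>2) \<ge> 0"
      using quad[of b "- a"] by (simp add: algebra_simps power2_eq_square)
    then show ?thesis using \<open>a \<ge> 0\<close> False
      by (metis diff_ge_0_iff_ge less_eq_real_def mult_pos_neg not_le)
  qed
  then show ?thesis by (simp add: a_def b_def c_def)
qed

text \<open>Cauchy-Schwarz against \<open>A *v v\<close> bounds the fourth power of its norm by
  0.\<close>

lemma psd_zero_imp_kernel:
  assumes "psd A" "v \<bullet> (A *v v) = 0"
  shows "A *v v = 0"
  using psd_cauchy_schwarz[OF assms(1), of "A *v v" v] assms(2) by simp

text \<open>This is the Schur complement step: the subtracted form is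
  \<open>(h \<bullet> (A *v axis a 1))\<^sup>2 / A $ a $ a\<close>, which Cauchy-Schwarz bounds by
  the form of \<open>A\<close>.\<close>

lemma psd_diff_pivot:
  assumes "psd A" and "0 < A $ a $ a"
  shows "psd (A - outer ((1 / sqrt (A $ a $ a)) *\<^sub>R (A *v axis a 1)))"
proof -
  let ?v = "(1 / sqrt (A $ a $ a)) *\<^sub>R (A *v axis a 1)"
  have sym: "transpose A = A" using assms by (auto simp: psd_def)
  have ax: "axis a 1 \<bullet> (A *v axis a 1) = A $ a $ a"
    by (simp add: matrix_vector_mult_basis inner_axis' column_def)
  have "0 \<le> h \<bullet> ((A - outer ?v) *v h)" for h
  proof -
    have "(h \<bullet> ?v)\<^sup>2 = (h \<bullet> (A *v axis a 1))\<^sup>2 / A $ a $ a"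
      using assms(2) by (simp add: power_divide)
    also have "\<dots> \<le> h \<bullet> (A *v h)"
      using psd_cauchy_schwarz[OF assms(1), of h "axis a 1"] assms(2) ax
      by (simp add: field_simps)
    finally show ?thesis
      by (simp add: matrix_vector_mult_diff_rdistrib outer_mult_vector inner_diff_right
          power2_eq_square inner_commute)
  qed
  moreover have "transpose (A - outer ?v) = A - outer ?v"
    using sym transpose_outer[of ?v] by (simp add: vec_eq_iff transpose_def)
  ultimately show ?thesis by (simp add: psd_def)
qed

text \<open>Symmetric Gaussian elimination: each pivot splits off one rank-one summand.\<close>

lemma psd_eq_sum_outer_aux:
  assumes "finite S" "psd A" "\<And>i j. i \<notin> S \<Longrightarrow> A $ i $ j = 0"
  shows "\<exists>r. A = (\<Sum>a\<in>S. outer (r a))"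
  using assms
proof (induction S arbitrary: A rule: finite_induct)
  case empty
  then have "A = 0" by (simp add: vec_eq_iff)
  then show ?case by simp
next
  case (insert a S)
  have sym: "A $ i $ j = A $ j $ i" for i j
    using insert.prems(1) unfolding psd_def by (metis transpose_def vec_lambda_beta)
  have psdA: "psd A" by fact
  have ax: "axis a 1 \<bullet> (A *v axis a 1) = A $ a $ a"
    by (simp add: matrix_vector_mult_basis inner_axis' column_def)
  have ge: "A $ a $ a \<ge> 0" using psdA ax unfolding psd_def by metis
  have "\<exists>v. psd (A - outer v) \<and> (\<forall>i j. i \<notin> S \<longrightarrow> (A - outer v) $ i $ j = 0)"
  proof (cases "A $ a $ a = 0")
    case True
    \<comment> \<open>A zero pivot annihilates its whole row and column, so the zero vector can be
      split off.\<close>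
    then have "A *v axis a 1 = 0" using psd_zero_imp_kernel[OF psdA] ax by simp
    then have "A $ j $ a = 0" for j
      by (simp add: matrix_vector_mult_basis column_def vec_eq_iff)
    then have "(A - outer 0) $ i $ j = 0" if "i \<notin> S" for i j
      using that insert.prems(2)[of i j] sym[of a j] by (cases "i = a") (auto simp: outer_def)
    moreover have "A - outer 0 = A" by (simp add: vec_eq_iff outer_def)
    ultimately show ?thesis using psdA by metis
  next
    case False
    with ge have pos: "0 < A $ a $ a" by simp
    let ?v = "(1 / sqrt (A $ a $ a)) *\<^sub>R (A *v axis a 1)"
    have "(A - outer ?v) $ i $ j = A $ i $ j - A $ i $ a * A $ j $ a / A $ a $ a" for i j
      using pos by (simp add: outer_def matrix_vector_mult_basis column_def)
    \<comment> \<open>Row \<open>a\<close> cancels with the pivot; rows outside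
      \<open>insert a S\<close> were zero already.\<close>
    then have "(A - outer ?v) $ i $ j = 0" if "i \<notin> S" for i j
      using that insert.prems(2)[of i j] insert.prems(2)[of i a] sym[of a j] pos
      by (cases "i = a") auto
    then show ?thesis using psd_diff_pivot[OF psdA pos] by blast
  qed
  then obtain v where v: "psd (A - outer v)" "\<And>i j. i \<notin> S \<Longrightarrow> (A - outer v) $ i $ j = 0"
    by blast
  obtain r where r: "A - outer v = (\<Sum>b\<in>S. outer (r b))"
    using insert.IH[OF v] by blast
  have "(\<Sum>b\<in>insert a S. outer ((r(a := v)) b)) = outer v + (\<Sum>b\<in>S. outer ((r(a := v)) b))"
    using insert.hyps by simp
  also have "(\<Sum>b\<in>S. outer ((r(a := v)) b)) = (\<Sum>b\<in>S. outer (r b))"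
    using insert.hyps(2) by (intro sum.cong refl) (metis fun_upd_other)
  also have "outer v + \<dots> = A"
    unfolding r[symmetric] by simp
  finally show ?case by metis
qed

lemma psd_eq_sum_outer:
  fixes A :: "real ^ 'n ^ 'n::finite"
  assumes "psd A"
  obtains r :: "'n \<Rightarrow> real ^ 'n" where "A = (\<Sum>a\<in>UNIV. outer (r a))"
proof -
  have "\<exists>r::'n \<Rightarrow> real ^ 'n. A = (\<Sum>a\<in>UNIV. outer (r a))"
    by (rule psd_eq_sum_outer_aux[OF _ assms]) simp_all
  with that show thesis by blast
qed

section \<open>Traces of products and Cauchy-Schwarz inequalities for them\<close>

lemma matrix_mul_sum_left: "(\<Sum>i\<in>I. A i) ** B = (\<Sum>i\<in>I. A i ** B)"
  for B :: "real ^ 'k ^ 'm::finite"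
  by (simp add: vec_eq_iff matrix_matrix_mult_def sum_distrib_right) (intro allI sum.swap)

lemma matrix_mul_sum_right: "B ** (\<Sum>i\<in>I. A i) = (\<Sum>i\<in>I. B ** A i)"
  for B :: "real ^ 'm::finite ^ 'k"
  by (simp add: vec_eq_iff matrix_matrix_mult_def sum_distrib_left) (intro allI sum.swap)

lemma trace_sum: "trace (\<Sum>i\<in>I. A i) = (\<Sum>i\<in>I. trace (A i))"
  for A :: "'i \<Rightarrow> real ^ 'n ^ 'n::finite"
  by (simp add: trace_def) (rule sum.swap)

lemma trace_scaleR: "trace (c *\<^sub>R A) = c * trace A"
  for A :: "real ^ 'n ^ 'n::finite"
  by (simp add: trace_def sum_distrib_left)

lemma trace_outer_mul: "trace (outer u ** A) = u \<bullet> (A *v u)"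
  by (simp add: trace_def outer_def matrix_matrix_mult_def matrix_vector_mult_def inner_vec_def
      sum_distrib_left mult_ac) (subst sum.swap, simp add: mult_ac)

lemma outer_mul_mul_outer: "outer u ** A ** outer v = (u \<bullet> (A *v v)) *\<^sub>R (\<chi> i j. u $ i * v $ j)"
  by (simp add: vec_eq_iff outer_def matrix_matrix_mult_def matrix_vector_mult_def inner_vec_def
      sum_distrib_left sum_distrib_right mult_ac) (subst sum.swap, simp add: mult_ac)

lemma trace_outer_mul_outer_mul:
  "trace (outer u ** A ** outer v ** B) = (u \<bullet> (A *v v)) * (v \<bullet> (B *v u))"
proof -
  have "trace ((\<chi> i j. u $ i * v $ j) ** B) = v \<bullet> (B *v u)"
    by (simp add: trace_def matrix_matrix_mult_def matrix_vector_mult_def inner_vec_def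
      sum_distrib_left mult_ac) (subst sum.swap, simp add: mult_ac)
  then show ?thesis
    unfolding outer_mul_mul_outer scalar_matrix_assoc[symmetric] trace_scaleR by simp
qed

text \<open>Splitting matrices into rank-one terms reduces the trace inequalities below to
  inequalities between double sums of real numbers.\<close>

lemma trace_mul_sum_outer:
  "trace ((\<Sum>a\<in>I. outer (u a)) ** A ** (\<Sum>b\<in>J. outer (v b)) ** B)
     = (\<Sum>a\<in>I. \<Sum>b\<in>J. (u a \<bullet> (A *v v b)) * (v b \<bullet> (B *v u a)))"
  unfolding matrix_mul_sum_left matrix_mul_sum_right trace_sum trace_outer_mul_outer_mul
  by (rule sum.swap)

lemma matrix_mul_add_left: "(A + B) ** C = A ** C + B ** C"
  for C :: "real ^ 'm::finite ^ 'n"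
  by (simp add: vec_eq_iff matrix_matrix_mult_def distrib_right sum.distrib)

lemma matrix_mul_diff_left: "(A - B) ** C = A ** C - B ** C"
  for C :: "real ^ 'm::finite ^ 'n"
  by (simp add: vec_eq_iff matrix_matrix_mult_def left_diff_distrib sum_subtractf)

lemma matrix_mul_diff_right: "A ** (B - C) = A ** B - A ** C"
  for C :: "real ^ 'm::finite ^ 'n"
  by (simp add: vec_eq_iff matrix_matrix_mult_def right_diff_distrib sum_subtractf)

text \<open>With \<open>P\<close> the sum of the \<open>outer (r a)\<close>, the trace is the sum of
  the squares \<open>(r a \<bullet> (A *v r b))\<^sup>2\<close>.\<close>

lemma trace_sandwich_nonneg:
  fixes P :: "real ^ 'n ^ 'n::finite"
  assumes "psd P" "transpose A = A"
  shows "0 \<le> trace (P ** A ** P ** A)"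
proof -
  obtain r :: "'n \<Rightarrow> real ^ 'n" where r: "P = (\<Sum>a\<in>UNIV. outer (r a))" using psd_eq_sum_outer[OF assms(1)] .
  have "(x \<bullet> (A *v y)) * (y \<bullet> (A *v x)) = (x \<bullet> (A *v y))\<^sup>2" for x y
    using symmetric_dot[OF assms(2), of y x] by (simp add: power2_eq_square inner_commute)
  then show ?thesis unfolding r trace_mul_sum_outer by (simp add: sum_nonneg)
qed

text \<open>The mixed trace is the Euclidean inner product of the arrays
  \<open>r a \<bullet> (A *v r b)\<close> and \<open>r a \<bullet> (B *v r b)\<close>.\<close>

lemma trace_sandwich_cauchy_schwarz:
  fixes P :: "real ^ 'n ^ 'n::finite"
  assumes "psd P" "transpose A = A" "transpose B = B"
  shows "(trace (P ** A ** P ** B))\<^sup>2 \<le> trace (P ** A ** P ** A) * trace (P ** B ** P ** B)"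
proof -
  obtain r :: "'n \<Rightarrow> real ^ 'n" where r: "P = (\<Sum>a\<in>UNIV. outer (r a))" using psd_eq_sum_outer[OF assms(1)] .
  have sw: "r b \<bullet> (C *v r a) = r a \<bullet> (C *v r b)" if "transpose C = C" for C a b
    using symmetric_dot[OF that, of "r b" "r a"] by (simp add: inner_commute)
  have "trace (P ** C ** P ** D) =
      (\<Sum>(a, b)\<in>UNIV. (r a \<bullet> (C *v r b)) * (r a \<bullet> (D *v r b)))" if "transpose D = D" for C D
    unfolding r trace_mul_sum_outer using sw[OF that]
    by (simp add: sum.cartesian_product)
  then show ?thesis
    using Cauchy_Schwarz_ineq_sum[of "\<lambda>(a, b). r a \<bullet> (A *v r b)" "\<lambda>(a, b). r a \<bullet> (B *v r b)" UNIV]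
      assms(2,3)
    by (simp add: case_prod_unfold power2_eq_square)
qed

text \<open>Here \<open>A\<close> and \<open>B\<close> are split instead of \<open>P\<close>, and
  Cauchy-Schwarz for the form of \<open>P\<close> bounds each squared term by a product. With
  \<open>P\<close> the inverse of \<open>\<Lambda>(y)\<close>, this bounds local inner products of
  psd directions by their pairings with \<open>t\<close>.\<close>

lemma trace_sandwich_le_mult_trace:
  fixes P :: "real ^ 'n ^ 'n::finite"
  assumes "psd P" "psd A" "psd B"
  shows "\<bar>trace (P ** A ** P ** B)\<bar> \<le> trace (P ** A) * trace (P ** B)"
proof -
  obtain a :: "'n \<Rightarrow> real ^ 'n" where a: "A = (\<Sum>k\<in>UNIV. outer (a k))" using psd_eq_sum_outer[OF assms(2)] .
  obtain b :: "'n \<Rightarrow> real ^ 'n" where b: "B = (\<Sum>k\<in>UNIV. outer (b k))" using psd_eq_sum_outer[OF assms(3)] .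
  have sym: "transpose P = P" using assms(1) by (simp add: psd_def)
  have sq: "(a k \<bullet> (P *v b l)) * (b l \<bullet> (P *v a k)) = (a k \<bullet> (P *v b l))\<^sup>2" for k l
    using symmetric_dot[OF sym, of "b l" "a k"] by (simp add: power2_eq_square inner_commute)
  have "trace (P ** A ** P ** B) = trace (A ** P ** B ** P)"
    using trace_mul_sym[of P "A ** P ** B"] by (simp add: matrix_mul_assoc)
  also have "\<dots> = (\<Sum>k\<in>UNIV. \<Sum>l\<in>UNIV. (a k \<bullet> (P *v b l))\<^sup>2)"
    unfolding a b trace_mul_sum_outer sq ..
  finally have eq: "trace (P ** A ** P ** B) = (\<Sum>k\<in>UNIV. \<Sum>l\<in>UNIV. (a k \<bullet> (P *v b l))\<^sup>2)" .
  also have "\<dots> \<le> (\<Sum>k\<in>UNIV. \<Sum>l\<in>UNIV. (a k \<bullet> (P *v a k)) * (b l \<bullet> (P *v b l)))"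
    by (intro sum_mono psd_cauchy_schwarz assms)
  also have "\<dots> = trace (A ** P) * trace (B ** P)"
    unfolding a b matrix_mul_sum_left trace_sum trace_outer_mul sum_product ..
  finally show ?thesis
    using eq by (simp add: trace_mul_sym[of P] sum_nonneg)
qed

section \<open>Inverse matrices\<close>

lemma
  fixes A :: "real ^ 'n ^ 'n::finite"
  assumes "invertible A"
  shows matrix_inv_right: "A ** matrix_inv A = mat 1"
    and matrix_inv_left: "matrix_inv A ** A = mat 1"
  using someI_ex[OF assms[unfolded invertible_def]] by (simp_all add: matrix_inv_def)

lemma pd_imp_invertible: "pd A \<Longrightarrow> invertible A"
  unfolding invertible_left_inverse matrix_left_invertible_ker pd_def
  by (metis inner_zero_right less_irrefl)

lemma matrix_inv_unique: "A ** B = mat 1 \<Longrightarrow> matrix_inv A = B"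
  for A :: "real ^ 'n ^ 'n::finite"
  by (metis invertible_right_inverse matrix_inv_left matrix_mul_assoc matrix_mul_lid
      matrix_mul_rid)

lemma matrix_inv_scaleR:
  fixes A :: "real ^ 'n ^ 'n::finite"
  assumes "invertible A" "c \<noteq> 0"
  shows "matrix_inv (c *\<^sub>R A) = (1 / c) *\<^sub>R matrix_inv A"
  by (rule matrix_inv_unique)
    (use assms in \<open>simp add: matrix_scalar_ac matrix_inv_right flip: scalar_matrix_assoc\<close>)

lemma pd_matrix_inv:
  assumes "pd A"
  shows "pd (matrix_inv A)"
proof -
  have inv: "invertible A" and sym: "transpose A = A"
    using assms pd_imp_invertible by (auto simp: pd_def)
  have "A ** transpose (matrix_inv A) = mat 1"
    by (metis inv matrix_inv_left matrix_transpose_mul sym transpose_mat)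
  then have "transpose (matrix_inv A) = matrix_inv A"
    using matrix_inv_unique by metis
  moreover have "0 < h \<bullet> (matrix_inv A *v h)" if "h \<noteq> 0" for h
  proof -
    have Au: "A *v (matrix_inv A *v h) = h"
      by (simp add: matrix_vector_mul_assoc matrix_inv_right[OF inv])
    then have "matrix_inv A *v h \<noteq> 0" using that by auto
    then have "0 < (matrix_inv A *v h) \<bullet> (A *v (matrix_inv A *v h))"
      using assms by (auto simp: pd_def)
    then show ?thesis by (simp add: Au inner_commute)
  qed
  ultimately show ?thesis by (simp add: pd_def)
qed

text \<open>Trace Cauchy-Schwarz is applied to \<open>V\<close> and the rank-one matrix built from
  \<open>X *v h\<close>, whose local pairing with \<open>V\<close> is
  \<open>h \<bullet> (V *v h)\<close> and whose local norm is \<open>h \<bullet> (X *v h)\<close>.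
  Thus the local norm of \<open>V\<close> bounds its form relative to that of
  \<open>X\<close>.\<close>

lemma quadratic_form_le_local_norm:
  assumes "pd X" "transpose V = V"
  shows "(h \<bullet> (V *v h))\<^sup>2
    \<le> trace (matrix_inv X ** V ** matrix_inv X ** V) * (h \<bullet> (X *v h))\<^sup>2"
proof -
  let ?P = "matrix_inv X" and ?B = "outer (X *v h)"
  have sym: "transpose X = X" using assms by (simp add: pd_def)
  have P: "?P *v (X *v x) = x" for x
    using matrix_inv_left[OF pd_imp_invertible[OF assms(1)]]
    by (simp add: matrix_vector_mul_assoc)
  have symP: "transpose ?P = ?P" using pd_matrix_inv[OF assms(1)] by (simp add: pd_def)
  have "trace (?P ** V ** ?P ** ?B) = (X *v h) \<bullet> ((?P ** V ** ?P) *v (X *v h))"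
    using trace_mul_sym[of "?P ** V ** ?P" ?B] by (simp add: trace_outer_mul)
  also have "\<dots> = h \<bullet> (V *v h)"
    using symmetric_dot[OF symP, of "X *v h" "V *v h"]
    by (simp add: P flip: matrix_vector_mul_assoc)
  finally have 1: "trace (?P ** V ** ?P ** ?B) = h \<bullet> (V *v h)" .
  have "trace (?P ** ?B ** ?P ** ?B) = ((X *v h) \<bullet> (?P *v (X *v h)))\<^sup>2"
    using trace_mul_sym[of ?P "?B ** ?P ** ?B"] trace_outer_mul_outer_mul[of "X *v h" ?P "X *v h" ?P]
    by (simp add: matrix_mul_assoc power2_eq_square)
  then have 2: "trace (?P ** ?B ** ?P ** ?B) = (h \<bullet> (X *v h))\<^sup>2"
    by (simp add: P inner_commute)
  show ?thesis
    using trace_sandwich_cauchy_schwarz[OF pd_imp_psd[OF pd_matrix_inv[OF assms(1)]] assms(2)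
        transpose_outer[of "X *v h"]] 1 2 by simp
qed

text \<open>Inside the unit ball of the local norm the form of \<open>V\<close> is strictly
  dominated by that of \<open>X\<close>. This ball is the Dikin ellipsoid of the log-determinant
  barrier.\<close>

lemma pd_add_local_ball:
  assumes "pd X" "transpose V = V" "trace (matrix_inv X ** V ** matrix_inv X ** V) < 1"
  shows "pd (X + V)"
proof -
  have "0 < h \<bullet> ((X + V) *v h)" if "h \<noteq> 0" for h
  proof -
    have pos: "0 < h \<bullet> (X *v h)" using assms(1) that by (simp add: pd_def)
    have "(h \<bullet> (V *v h))\<^sup>2 < 1 * (h \<bullet> (X *v h))\<^sup>2"
      by (rule le_less_trans[OF quadratic_form_le_local_norm[OF assms(1,2)]])
        (use pos assms(3) in \<open>intro mult_strict_right_mono; simp\<close>)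
    then have "\<bar>h \<bullet> (V *v h)\<bar> < h \<bullet> (X *v h)"
      using pos by (intro power2_less_imp_less[of _ "h \<bullet> (X *v h)"]) auto
    then show ?thesis by (simp add: matrix_vector_mult_add_rdistrib inner_add_right)
  qed
  then show ?thesis using assms by (simp add: pd_def transpose_add)
qed

text \<open>The closed ball still gives semidefiniteness, enough to place
  \<open>H(x)\<inverse> t\<close> in the dual cone.\<close>

lemma psd_add_local_ball:
  assumes "pd X" "transpose V = V" "trace (matrix_inv X ** V ** matrix_inv X ** V) \<le> 1"
  shows "psd (X + V)"
proof -
  have "0 \<le> h \<bullet> ((X + V) *v h)" for h
  proof -
    have pos: "0 \<le> h \<bullet> (X *v h)" using pd_imp_psd[OF assms(1)] by (simp add: psd_def)
    have "(h \<bullet> (V *v h))\<^sup>2 \<le> 1 * (h \<bullet> (X *v h))\<^sup>2"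
      by (rule order_trans[OF quadratic_form_le_local_norm[OF assms(1,2)]])
        (use assms(3) in \<open>intro mult_right_mono; simp\<close>)
    then have "\<bar>h \<bullet> (V *v h)\<bar> \<le> h \<bullet> (X *v h)"
      using pos by (simp add: abs_le_square_iff[symmetric])
    then show ?thesis by (simp add: matrix_vector_mult_add_rdistrib inner_add_right)
  qed
  then show ?thesis using assms by (simp add: psd_def pd_def transpose_add)
qed

text \<open>Bounds the change of the gradient of the log-determinant barrier in the dual local norm
  at \<open>X\<close> by the local norm of \<open>X - Y\<close> at \<open>Y\<close>.\<close>

lemma trace_matrix_inv_diff:
  assumes X: "pd X" and Y: "pd Y" and D: "transpose D = D"
  shows "(trace ((matrix_inv Y - matrix_inv X) ** D))\<^sup>2
    \<le> trace (matrix_inv Y ** (X - Y) ** matrix_inv Y ** (X - Y))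
      * trace (matrix_inv X ** D ** matrix_inv X ** D)"
proof -
  let ?P = "matrix_inv X" and ?Q = "matrix_inv Y"
  \<comment> \<open>\<open>A\<close> is chosen so that sandwiching it between two copies of
    \<open>?P\<close> gives \<open>?Q - ?P\<close>, while \<open>?P ** A\<close> is
    \<open>?Q ** (X - Y)\<close>.\<close>
  define A where "A = X ** ?Q ** X - X"
  have PX: "?P ** X = mat 1" "X ** ?P = mat 1" and QY: "?Q ** Y = mat 1"
    using X Y by (simp_all add: matrix_inv_left matrix_inv_right pd_imp_invertible)
  have symX: "transpose X = X" and symQ: "transpose ?Q = ?Q"
    using X pd_matrix_inv[OF Y] by (simp_all add: pd_def)
  have "transpose (X ** ?Q ** X) = X ** ?Q ** X"
    by (simp add: matrix_transpose_mul symX symQ matrix_mul_assoc)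
  then have symA: "transpose A = A"
    using symX by (simp add: A_def vec_eq_iff transpose_def)
  have PA: "?P ** A = ?Q ** (X - Y)"
    by (simp add: A_def matrix_mul_diff_right matrix_mul_assoc PX QY)
  have "?P ** A ** ?P = ?Q ** X ** ?P - ?P"
    by (simp add: A_def matrix_mul_diff_right matrix_mul_assoc PX matrix_mul_diff_left)
  also have "\<dots> = ?Q - ?P"
    by (simp add: PX flip: matrix_mul_assoc)
  finally have PAP: "?P ** A ** ?P = ?Q - ?P" .
  have "?P ** A ** ?P ** A = ?Q ** (X - Y) ** ?Q ** (X - Y)"
    by (metis PA matrix_mul_assoc)
  then show ?thesis
    using trace_sandwich_cauchy_schwarz[OF pd_imp_psd[OF pd_matrix_inv[OF X]] symA D]
    by (simp add: PAP)
qed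

section \<open>Derivatives of the determinant and of the inverse\<close>

lemma has_derivative_vec_lambda:
  fixes f :: "'a::real_normed_vector \<Rightarrow> 'i::finite \<Rightarrow> real"
  assumes "\<And>i. ((\<lambda>x. f x i) has_derivative (\<lambda>h. f' h i)) (at a within S)"
  shows "((\<lambda>x. \<chi> i. f x i) has_derivative (\<lambda>h. \<chi> i. f' h i)) (at a within S)"
  unfolding has_derivative_componentwise_within[of "\<lambda>x. \<chi> i. f x i"]
  using assms by (auto simp: Basis_vec_def inner_axis)

text \<open>In the Leibniz expansion, a permutation other than the identity moves at least two
  points, so a zero entry remains after one factor is differentiated; only the diagonal product
  contributes.\<close>

lemma det_has_derivative_mat_1: "(det has_derivative trace) (at (mat 1 :: real ^ 'n ^ 'n::finite))"
proof -
  let ?P = "{p. p permutes (UNIV :: 'n set)}" and ?I = "mat 1 :: real ^ 'n ^ 'n"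
  have "(det has_derivative (\<lambda>V. \<Sum>p\<in>?P. of_int (sign p) *
      (\<Sum>i\<in>UNIV. V $ i $ p i * (\<Prod>j\<in>UNIV - {i}. ?I $ j $ p j)))) (at ?I)"
    unfolding det_def[abs_def]
    by (auto intro!: derivative_eq_intros bounded_linear_imp_has_derivative
        bounded_linear_compose[OF bounded_linear_vec_nth bounded_linear_vec_nth])
  moreover have "(\<Sum>p\<in>?P. of_int (sign p) *
      (\<Sum>i\<in>UNIV. V $ i $ p i * (\<Prod>j\<in>UNIV - {i}. ?I $ j $ p j))) = trace V" for V :: "real ^ 'n ^ 'n"
  proof -
    have zero: "(\<Prod>j\<in>UNIV - {i}. ?I $ j $ p j) = 0" if p: "p permutes UNIV" "p \<noteq> id" for p i
    proof -
      obtain k where "p k \<noteq> k" using p(2) by (metis eq_id_iff)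
      \<comment> \<open>If the moved point \<open>k\<close> is \<open>i\<close> itself, injectivity
        makes its image another moved point.\<close>
      then obtain j where "j \<noteq> i" "p j \<noteq> j"
        using p(1) by (metis permutes_inj inj_eq)
      then show ?thesis by (intro prod_zero bexI[of _ j]) (auto simp: mat_def)
    qed
    have "(\<Sum>p\<in>?P. of_int (sign p) *
        (\<Sum>i\<in>UNIV. V $ i $ p i * (\<Prod>j\<in>UNIV - {i}. ?I $ j $ p j)))
      = (\<Sum>p\<in>{id}. of_int (sign p) *
        (\<Sum>i\<in>UNIV. V $ i $ p i * (\<Prod>j\<in>UNIV - {i}. ?I $ j $ p j)))"
    proof (intro sum.mono_neutral_right ballI)
      fix p assume "p \<in> ?P - {id}"
      then show "of_int (sign p) *
          (\<Sum>i\<in>UNIV. V $ i $ p i * (\<Prod>j\<in>UNIV - {i}. ?I $ j $ p j)) = 0"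
        using zero[of p] by (simp del: prod_zero_iff)
    qed (auto simp: permutes_id finite_permutations)
    also have "\<dots> = trace V" by (simp add: trace_def mat_def sign_id)
    finally show ?thesis .
  qed
  ultimately show ?thesis by (metis (no_types, lifting) has_derivative_eq_rhs ext)
qed

lemma linear_matrix_mul_right: "linear (\<lambda>B. A ** B)" for A :: "real ^ 'm::finite ^ 'n::finite"
  by (rule linearI) (simp_all add: matrix_add_ldistrib matrix_scalar_ac scalar_matrix_assoc)

lemma linear_matrix_mul_left: "linear (\<lambda>A. A ** B)" for B :: "real ^ 'm::finite ^ 'n::finite"
  by (rule linearI) (simp_all add: matrix_mul_add_left scalar_matrix_assoc)

lemma linear_trace: "linear (trace :: real ^ 'n ^ 'n::finite \<Rightarrow> real)"
  by (rule linearI) (simp_all add: trace_add trace_scaleR)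

text \<open>Factoring \<open>B\<close> as \<open>A\<close> times \<open>matrix_inv A ** B\<close>
  moves the base point to the identity.\<close>

lemma det_has_derivative:
  fixes A :: "real ^ 'n ^ 'n::finite"
  assumes "invertible A"
  shows "(det has_derivative (\<lambda>V. det A * trace (matrix_inv A ** V))) (at A)"
proof -
  have "((\<lambda>B. matrix_inv A ** B) has_derivative (\<lambda>V. matrix_inv A ** V)) (at A)"
    by (intro linear_imp_has_derivative linear_matrix_mul_right)
  then have "((\<lambda>B. det (matrix_inv A ** B)) has_derivative (\<lambda>V. trace (matrix_inv A ** V))) (at A)"
    using has_derivative_compose[of "\<lambda>B. matrix_inv A ** B" "\<lambda>V. matrix_inv A ** V" A UNIV det trace]
      det_has_derivative_mat_1 matrix_inv_left[OF assms] by metis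
  then have "((\<lambda>B. det A * det (matrix_inv A ** B)) has_derivative
      (\<lambda>V. det A * trace (matrix_inv A ** V))) (at A)"
    by (rule has_derivative_mult_right)
  moreover have "det A * det (matrix_inv A ** B) = det B" for B
    by (metis assms det_mul matrix_inv_right matrix_mul_assoc matrix_mul_lid)
  ultimately show ?thesis by simp
qed

lemma continuous_on_det: "continuous_on UNIV (det :: real ^ 'n ^ 'n::finite \<Rightarrow> real)"
  unfolding det_def[abs_def] by (intro continuous_intros)

lemma isCont_det: "isCont det A" for A :: "real ^ 'n ^ 'n::finite"
  using continuous_on_det by (metis UNIV_I continuous_on_eq_continuous_at open_UNIV)

text \<open>The segment from the identity to \<open>A\<close> consists of positive definite, hence
  invertible, matrices if \<open>A\<close> is one, so the determinant cannot change sign along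
  it.\<close>

lemma pd_imp_det_pos:
  assumes "pd A"
  shows "0 < det A"
proof (rule ccontr)
  assume "\<not> 0 < det A"
  define B where "B s = (1 - s) *\<^sub>R mat 1 + s *\<^sub>R A" for s :: real
  have "continuous_on {0..1} (\<lambda>s. det (B s))"
    unfolding B_def
    by (intro continuous_on_compose2[OF continuous_on_det] continuous_intros) auto
  then obtain s where s: "0 \<le> s" "s \<le> 1" "det (B s) = 0"
    using IVT2'[of "\<lambda>s. det (B s)" 1 0 0] \<open>\<not> 0 < det A\<close> by (auto simp: B_def)
  have "pd (B s)"
  proof -
    have "0 < h \<bullet> (B s *v h)" if "h \<noteq> 0" for h
    proof -
      have "0 < h \<bullet> h" "0 < h \<bullet> (A *v h)" using assms that by (auto simp: pd_def)
      then have "0 < (1 - s) * (h \<bullet> h) + s * (h \<bullet> (A *v h))"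
        using s by (cases "s = 0") (auto intro!: add_nonneg_pos)
      then show ?thesis
        by (simp add: B_def matrix_vector_mult_add_rdistrib inner_add_right
            flip: scaleR_matrix_vector_assoc)
    qed
    then show ?thesis
      using assms by (simp add: pd_def B_def transpose_add transpose_scaleR)
  qed
  with s(3) show False using pd_imp_invertible invertible_det_nz by blast
qed

lemma bounded_bilinear_matrix_mult:
  "bounded_bilinear (\<lambda>(A :: real ^ 'm::finite ^ 'n::finite) (B :: real ^ 'k::finite ^ 'm). A ** B)"
  unfolding bilinear_conv_bounded_bilinear[symmetric] bilinear_def
  using linear_matrix_mul_left linear_matrix_mul_right by blast

text \<open>Cramer's rule writes the entries of the inverse near \<open>A\<close> as quotients of
  determinants with nonvanishing denominator.\<close>

lemma isCont_matrix_inv: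
  fixes A :: "real ^ 'n ^ 'n::finite"
  assumes "invertible A"
  shows "isCont matrix_inv A"
proof -
  define C :: "'n \<Rightarrow> 'n \<Rightarrow> real ^ 'n ^ 'n \<Rightarrow> real ^ 'n ^ 'n"
    where "C k j B = (\<chi> i l. if l = k then axis j 1 $ i else B $ i $ l)" for k j B
  define F :: "real ^ 'n ^ 'n \<Rightarrow> real ^ 'n ^ 'n"
    where "F B = (\<chi> k j. det (C k j B) / det B)" for B
  have det: "det A \<noteq> 0" using assms invertible_det_nz by blast
  have "matrix_inv B = F B" if "det B \<noteq> 0" for B
  proof -
    have "B ** matrix_inv B = mat 1" using that matrix_inv_right invertible_det_nz by blast
    then have "B *v (matrix_inv B *v axis j 1) = axis j 1" for j
      by (simp add: matrix_vector_mul_assoc)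
    then have "matrix_inv B *v axis j 1 = (\<chi> k. det (C k j B) / det B)" for j
      using cramer[OF that, of "matrix_inv B *v axis j 1" "axis j 1"] by (simp add: C_def)
    then show ?thesis
      by (simp add: F_def vec_eq_iff matrix_vector_mult_basis column_def)
  qed
  moreover have "eventually (\<lambda>B. det B \<noteq> 0) (at A)"
    using det isCont_det[of A] by (simp add: isCont_def tendsto_imp_eventually_ne)
  ultimately have ev: "eventually (\<lambda>B. F B = matrix_inv B) (at A)"
    by (auto elim: eventually_mono)
  have "isCont (C k j) A" for k j
  proof -
    have "isCont (\<lambda>B :: real ^ 'n ^ 'n. if l = k then axis j 1 $ i else B $ i $ l) A" for i l
      by (cases "l = k") (auto intro!: continuous_intros)
    then show ?thesis
      unfolding C_def isCont_def by (intro tendsto_vec_lambda) auto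
  qed
  then have "isCont (\<lambda>B. det (C k j B)) A" for k j
    by (rule isCont_o2[OF _ isCont_det])
  then have "isCont F A"
    unfolding F_def isCont_def using det isCont_det[of A, unfolded isCont_def]
    by (intro tendsto_vec_lambda tendsto_divide) auto
  then have "F \<midarrow>A\<rightarrow> matrix_inv A"
    using \<open>\<And>B. det B \<noteq> 0 \<Longrightarrow> matrix_inv B = F B\<close>[OF det] by (simp add: isCont_def)
  then show ?thesis
    unfolding isCont_def using tendsto_cong[OF ev] by blast
qed

text \<open>The first-order remainder at \<open>B\<close> equals minus
  \<open>(matrix_inv B - matrix_inv A) ** (B - A) ** matrix_inv A\<close>; divided by
  \<open>norm (B - A)\<close> it tends to 0 by continuity of inversion.\<close>

lemma matrix_inv_has_derivative:
  fixes A :: "real ^ 'n ^ 'n::finite"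
  assumes "invertible A"
  shows "(matrix_inv has_derivative (\<lambda>V. - (matrix_inv A ** V ** matrix_inv A))) (at A)"
proof -
  let ?I = "matrix_inv A"
  obtain K where K: "\<And>(A :: real ^ 'n ^ 'n) (B :: real ^ 'n ^ 'n). norm (A ** B) \<le> norm A * norm B * K" and "K > 0"
    using bounded_bilinear.pos_bounded[OF bounded_bilinear_matrix_mult] by blast
  have lin: "linear (\<lambda>V. - (?I ** V ** ?I))"
    by (intro linear_compose_neg linear_compose[OF linear_matrix_mul_right linear_matrix_mul_left, unfolded o_def])
  have ev: "eventually (\<lambda>B. invertible B) (at A)"
    using assms isCont_det[of A] unfolding invertible_det_nz isCont_def by (simp add: tendsto_imp_eventually_ne)
  have bound: "norm ((1 / norm (B - A)) *\<^sub>R (matrix_inv B - (?I + - (?I ** (B - A) ** ?I))))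
      \<le> norm (matrix_inv B - ?I) * (norm ?I * K * K)" if B: "invertible B" for B
  proof (cases "B = A")
    case False
    have "(matrix_inv B - ?I) ** (B - A) ** ?I
        = matrix_inv B ** B ** ?I - matrix_inv B ** (A ** ?I) - ?I ** (B - A) ** ?I"
      by (simp add: matrix_mul_diff_left matrix_mul_diff_right matrix_mul_assoc)
    also have "\<dots> = ?I - matrix_inv B - ?I ** (B - A) ** ?I"
      by (simp add: matrix_inv_left matrix_inv_right B assms)
    finally have "matrix_inv B - (?I + - (?I ** (B - A) ** ?I)) = - ((matrix_inv B - ?I) ** (B - A) ** ?I)"
      by simp
    then have "norm (matrix_inv B - (?I + - (?I ** (B - A) ** ?I)))
        = norm ((matrix_inv B - ?I) ** (B - A) ** ?I)" by (simp only: norm_minus_cancel)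
    also have "\<dots> \<le> norm ((matrix_inv B - ?I) ** (B - A)) * norm ?I * K" by (rule K)
    also have "\<dots> \<le> (norm (matrix_inv B - ?I) * norm (B - A) * K) * norm ?I * K"
      using K \<open>K > 0\<close> by (intro mult_right_mono) auto
    finally have "norm (matrix_inv B - (?I + - (?I ** (B - A) ** ?I)))
        \<le> norm (B - A) * (norm (matrix_inv B - ?I) * (norm ?I * K * K))" by (simp add: mult_ac)
    then show ?thesis using False unfolding norm_scaleR by (simp add: divide_le_eq mult.commute)
  qed (use \<open>K > 0\<close> in simp)
  have lim: "((\<lambda>B. norm (matrix_inv B - ?I) * (norm ?I * K * K)) \<longlongrightarrow> 0) (at A)"
    using isCont_matrix_inv[OF assms] unfolding isCont_def
    by (intro tendsto_mult_left_zero tendsto_norm_zero) (simp add: LIM_zero)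
  have "((\<lambda>B. (1 / norm (B - A)) *\<^sub>R (matrix_inv B - (?I + - (?I ** (B - A) ** ?I)))) \<longlongrightarrow> 0) (at A)"
    by (rule Lim_null_comparison[OF eventually_mono[OF ev bound] lim])
  then show ?thesis
    unfolding has_derivative_within using lin by (simp only: linear_linear)
qed

section \<open>Extreme eigenvalues of a symmetric matrix\<close>

text \<open>Eigenvectors for distinct eigenvalues are orthogonal, hence independent. Finiteness
  gives \<open>Max\<close> and \<open>Min\<close> in \<open>cond\<close> their meaning.\<close>

lemma eigenvalues_finite:
  fixes M :: "real ^ 'n ^ 'n::finite"
  assumes "transpose M = M"
  shows "finite (eigenvalues M)"
proof -
  have "\<forall>c\<in>eigenvalues M. \<exists>v. v \<noteq> 0 \<and> M *v v = c *\<^sub>R v" by (simp add: eigenvalues_def)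
  then obtain v where v: "\<And>c. c \<in> eigenvalues M \<Longrightarrow> v c \<noteq> 0 \<and> M *v v c = c *\<^sub>R v c"
    by (metis bchoice)
  have orth: "v c \<bullet> v c' = 0" if "c \<in> eigenvalues M" "c' \<in> eigenvalues M" "c \<noteq> c'" for c c'
    using symmetric_dot[OF assms, of "v c" "v c'"] v that by auto
  have inj: "inj_on v (eigenvalues M)"
    by (rule inj_onI) (metis orth v inner_eq_zero_iff)
  have "pairwise orthogonal (v ` eigenvalues M)"
    using orth by (auto simp: pairwise_def orthogonal_def)
  moreover have "0 \<notin> v ` eigenvalues M" using v by force
  ultimately have "finite (v ` eigenvalues M)"
    using pairwise_orthogonal_independent independent_imp_finite by blast
  then show ?thesis using inj finite_image_iff by blast
qed

text \<open>A maximiser \<open>u\<close> of the form on the unit sphere is an eigenvector: with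
  \<open>l\<close> the maximum, \<open>l *\<^sub>R mat 1 - M\<close> is psd and its form vanishes at
  \<open>u\<close>, so \<open>u\<close> is in its kernel.\<close>

lemma eigenvalue_ge_quadratic_form:
  fixes M :: "real ^ 'n ^ 'n::finite"
  assumes "transpose M = M"
  obtains l where "l \<in> eigenvalues M" "\<And>v. v \<bullet> (M *v v) \<le> l * (v \<bullet> v)"
proof -
  have "continuous_on (sphere 0 1) (\<lambda>v. v \<bullet> (M *v v))" by (intro continuous_intros)
  then obtain u where u: "norm u = 1" "\<And>v. norm v = 1 \<Longrightarrow> v \<bullet> (M *v v) \<le> u \<bullet> (M *v u)"
    using continuous_attains_sup[of "sphere (0 :: real ^ 'n) 1" "\<lambda>v. v \<bullet> (M *v v)"] by auto
  define l where "l = u \<bullet> (M *v u)"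
  have le: "v \<bullet> (M *v v) \<le> l * (v \<bullet> v)" for v
  proof (cases "v = 0")
    case False
    have "v \<bullet> (M *v v) / (norm v)\<^sup>2 \<le> l"
      using u(2)[of "(1 / norm v) *\<^sub>R v"] False
      by (simp add: l_def matrix_vector_mult_scaleR power2_eq_square)
    then show ?thesis using False by (simp add: field_simps power2_norm_eq_inner)
  qed simp
  define N where "N = l *\<^sub>R mat 1 - M"
  have N: "N *v v = l *\<^sub>R v - M *v v" for v
    by (simp add: N_def matrix_vector_mult_diff_rdistrib flip: scaleR_matrix_vector_assoc)
  have "transpose N = N"
    using assms by (simp add: N_def vec_eq_iff transpose_def mat_def)
  then have "psd N" using le by (simp add: psd_def N inner_diff_right)
  moreover have "u \<bullet> (N *v u) = 0"
    using u(1) by (simp add: N inner_diff_right l_def flip: power2_norm_eq_inner)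
  ultimately have "N *v u = 0" by (rule psd_zero_imp_kernel)
  then have "l \<in> eigenvalues M"
    using u(1) unfolding eigenvalues_def N by (auto intro!: exI[of _ u])
  then show thesis using le that by blast
qed

lemma quadratic_form_le_Max_eigenvalues:
  assumes "transpose M = M"
  shows "v \<bullet> (M *v v) \<le> Max (eigenvalues M) * (v \<bullet> v)"
proof -
  obtain l where l: "l \<in> eigenvalues M" "v \<bullet> (M *v v) \<le> l * (v \<bullet> v)"
    using eigenvalue_ge_quadratic_form[OF assms] by metis
  have "l * (v \<bullet> v) \<le> Max (eigenvalues M) * (v \<bullet> v)"
    by (intro mult_right_mono Max_ge eigenvalues_finite assms l) simp
  with l show ?thesis by linarith
qed

text \<open>The eigenvalue dominating the form of \<open>- M\<close> is, up to sign, an eigenvalue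
  of \<open>M\<close> that bounds its form from below.\<close>

lemma Min_eigenvalues_le_quadratic_form:
  fixes M :: "real ^ 'n ^ 'n::finite"
  assumes "transpose M = M"
  shows "Min (eigenvalues M) * (v \<bullet> v) \<le> v \<bullet> (M *v v)"
proof -
  have neg: "(- M) *v x = - (M *v x)" for x
    by (simp add: vec_eq_iff matrix_vector_mult_def sum_negf)
  have "transpose (- M) = - M" using assms by (simp add: vec_eq_iff transpose_def)
  then obtain l where l: "l \<in> eigenvalues (- M)" "\<And>v. v \<bullet> ((- M) *v v) \<le> l * (v \<bullet> v)"
    using eigenvalue_ge_quadratic_form by metis
  have "- l \<in> eigenvalues M"
    using l(1) unfolding eigenvalues_def neg by (auto simp: minus_equation_iff) (metis minus_minus)
  then have "Min (eigenvalues M) * (v \<bullet> v) \<le> - l * (v \<bullet> v)"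
    by (intro mult_right_mono Min_le eigenvalues_finite assms) auto
  then show ?thesis using l(2)[of v] by (simp add: neg)
qed

lemma eigenvalues_nonempty:
  fixes M :: "real ^ 'n ^ 'n::finite"
  shows "transpose M = M \<Longrightarrow> eigenvalues M \<noteq> {}"
  by (metis eigenvalue_ge_quadratic_form empty_iff)

lemma pd_imp_Min_eigenvalues_pos:
  assumes "pd M"
  shows "0 < Min (eigenvalues M)"
proof -
  have sym: "transpose M = M" using assms by (simp add: pd_def)
  have "0 < l" if l: "l \<in> eigenvalues M" for l
  proof -
    obtain v where v: "v \<noteq> 0" "M *v v = l *\<^sub>R v" using l by (auto simp: eigenvalues_def)
    have "0 < v \<bullet> (M *v v)" using assms v(1) by (simp add: pd_def)
    then have "0 < l * (v \<bullet> v)" by (simp add: v(2))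
    then show ?thesis by (rule zero_less_mult_pos2) (use v(1) in simp)
  qed
  then show ?thesis
    using eigenvalues_nonempty[OF sym] eigenvalues_finite[OF sym] by simp
qed

text \<open>With \<open>u\<close> solving \<open>M *v u = v\<close> and
  \<open>a = v \<bullet> u\<close>, the eigenvalue bound gives
  \<open>Min (eigenvalues M) * (u \<bullet> u) \<le> a\<close> and Cauchy-Schwarz gives
  \<open>a\<^sup>2 \<le> (v \<bullet> v) * (u \<bullet> u)\<close>; then
  \<open>u \<bullet> u\<close> is eliminated.\<close>

lemma quadratic_form_matrix_inv_le:
  assumes "pd M"
  shows "v \<bullet> (matrix_inv M *v v) \<le> (v \<bullet> v) / Min (eigenvalues M)"
proof -
  let ?l = "Min (eigenvalues M)" and ?u = "matrix_inv M *v v"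
  have sym: "transpose M = M" using assms by (simp add: pd_def)
  have l: "0 < ?l" by (rule pd_imp_Min_eigenvalues_pos[OF assms])
  have Mu: "M *v ?u = v"
    by (simp add: matrix_vector_mul_assoc matrix_inv_right pd_imp_invertible assms)
  define a where "a = v \<bullet> ?u"
  have la: "?l * (?u \<bullet> ?u) \<le> a"
    using Min_eigenvalues_le_quadratic_form[OF sym, of ?u] by (simp add: Mu a_def inner_commute)
  then have a0: "0 \<le> a" using l by (smt (verit) inner_ge_zero mult_nonneg_nonneg)
  have "a\<^sup>2 \<le> (v \<bullet> v) * (?u \<bullet> ?u)" unfolding a_def by (rule Cauchy_Schwarz_ineq)
  also have "\<dots> \<le> (v \<bullet> v) * (a / ?l)"
    using la l by (intro mult_left_mono) (auto simp: field_simps)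
  finally have "a * a \<le> a * ((v \<bullet> v) / ?l)" by (simp add: power2_eq_square mult_ac)
  then have "a \<le> (v \<bullet> v) / ?l"
  proof (cases "a = 0")
    case True
    then show ?thesis using l by simp
  next
    case False
    with a0 have "0 < a" by simp
    with \<open>a * a \<le> _\<close> show ?thesis by (rule mult_left_le_imp_le)
  qed
  then show ?thesis by (simp add: a_def)
qed

section \<open>Points in the interior of a cone and in its dual\<close>

text \<open>\<open>t\<close> can be moved a fixed distance against the direction of \<open>x\<close>
  without leaving \<open>C\<close>, and the pairing with \<open>x\<close> stays nonnegative. This
  makes slices of the dual cone bounded.\<close>

lemma interior_inner_dual_ge:
  fixes t :: "'a::real_inner"
  assumes "t \<in> interior C"
  obtains \<delta> where "0 < \<delta>" "\<And>x. x \<in> dual_cone C \<Longrightarrow> \<delta> * norm x \<le> t \<bullet> x"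
proof -
  obtain \<delta> where \<delta>: "0 < \<delta>" "cball t \<delta> \<subseteq> C" using assms mem_interior_cball by blast
  have "\<delta> * norm x \<le> t \<bullet> x" if x: "x \<in> dual_cone C" for x
  proof (cases "x = 0")
    case False
    have "t - (\<delta> / norm x) *\<^sub>R x \<in> C"
      using \<delta> False by (intro subsetD[OF \<delta>(2)]) (simp add: dist_norm)
    then have "0 \<le> (t - (\<delta> / norm x) *\<^sub>R x) \<bullet> x" using x by (simp add: dual_cone_def)
    moreover have "(\<delta> / norm x) * (x \<bullet> x) = \<delta> * norm x"
      using False by (simp add: power2_eq_square flip: power2_norm_eq_inner)
    ultimately show ?thesis by (simp add: inner_diff_left)
  qed simp
  with \<delta>(1) show thesis using that by blast
qed

lemma interior_inner_dual_pos:
  assumes "t \<in> interior C" "x \<in> dual_cone C" "x \<noteq> 0"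
  shows "0 < t \<bullet> x"
proof -
  obtain \<delta> where "0 < \<delta>" "\<And>x. x \<in> dual_cone C \<Longrightarrow> \<delta> * norm x \<le> t \<bullet> x"
    using interior_inner_dual_ge[OF assms(1)] by blast
  then have "0 < \<delta> * norm x" "\<delta> * norm x \<le> t \<bullet> x" using assms by auto
  then show ?thesis by linarith
qed

lemma dual_cone_scaleR: "x \<in> dual_cone C \<Longrightarrow> 0 \<le> c \<Longrightarrow> c *\<^sub>R x \<in> dual_cone C"
  by (simp add: dual_cone_def)

lemma closed_dual_cone: "closed (dual_cone C)"
proof -
  have "dual_cone C = (\<Inter>x\<in>C. {y. 0 \<le> x \<bullet> y})" by (auto simp: dual_cone_def)
  also have "closed \<dots>" by (intro closed_INT ballI closed_Collect_le continuous_intros)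
  finally show ?thesis .
qed

text \<open>The feasible set of \<open>k1\<close> is compact, and rescaling \<open>v0\<close> shows
  that it is nonempty, so the minimum is attained and \<open>LEAST\<close> denotes it; homogeneity
  extends the bound to all \<open>v\<close>.\<close>

lemma
  fixes e :: "real ^ 'u::finite"
  assumes "e \<in> interior C" "v0 \<in> dual_cone C" "v0 \<noteq> 0"
  shows k1_pos: "0 < k1 C e"
    and k1_le: "v \<in> dual_cone C \<Longrightarrow> k1 C e * infnorm v \<le> e \<bullet> v"
proof -
  let ?S = "dual_cone C \<inter> {v. infnorm v = 1}"
  have "bounded {v :: real ^ 'u. infnorm v = 1}"
    using norm_le_infnorm[where 'a = "real ^ 'u"] by (intro boundedI[of _ "sqrt DIM(real ^ 'u)"]) (metis mem_Collect_eq mult.right_neutral)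
  then have "compact ?S"
    by (intro closed_Int_compact closed_dual_cone)
      (auto simp: compact_eq_bounded_closed intro!: closed_Collect_eq continuous_intros)
  moreover have normalize: "(1 / infnorm v) *\<^sub>R v \<in> ?S" if "v \<in> dual_cone C" "v \<noteq> 0" for v
    using that by (simp add: dual_cone_scaleR infnorm_pos_le infnorm_mul infnorm_eq_0)
  then have "?S \<noteq> {}" using assms by blast
  moreover have "continuous_on ?S (\<lambda>v. e \<bullet> v)" by (intro continuous_intros)
  ultimately obtain u where u: "u \<in> ?S" "\<And>v. v \<in> ?S \<Longrightarrow> e \<bullet> u \<le> e \<bullet> v"
    using continuous_attains_inf by (metis (no_types, lifting))
  have k1: "k1 C e = e \<bullet> u"
    unfolding k1_def by (rule Least_equality) (use u in auto)
  have "u \<noteq> 0" using u(1) by (auto simp: infnorm_0)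
  then show "0 < k1 C e" using u(1) interior_inner_dual_pos[OF assms(1)] by (simp add: k1)
  show "k1 C e * infnorm v \<le> e \<bullet> v" if "v \<in> dual_cone C"
  proof (cases "v = 0")
    case False
    then show ?thesis
      using u(2)[OF normalize[OF that False]] infnorm_pos_lt[of v] by (simp add: k1 field_simps)
  qed (simp add: infnorm_0)
qed

section \<open>Logarithmic determinant barriers\<close>

text \<open>The barrier argument is separated from polynomials: \<open>L\<close> stands for
  \<Lambda> and \<open>C\<close> for \<Sigma>.\<close>

locale log_det_barrier =
  fixes L :: "real ^ 'u::finite \<Rightarrow> real ^ 'l ^ 'l::finite" and C :: "(real ^ 'u) set"
  assumes linear_L: "linear L"
    and symmetric_L: "transpose (L x) = L x"
    and psd_imp_dual: "psd (L x) \<Longrightarrow> x \<in> dual_cone C"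
    and interior_nonempty: "interior C \<noteq> {}"
begin

text \<open>This is the bilinear form of the Hessian of the barrier at \<open>x\<close>; on the
  diagonal it is the squared local norm.\<close>

abbreviation local_form :: "real ^ 'u \<Rightarrow> real ^ 'u \<Rightarrow> real ^ 'u \<Rightarrow> real" where
  "local_form x v k \<equiv> trace (matrix_inv (L x) ** L v ** matrix_inv (L x) ** L k)"

text \<open>A kernel vector and its negative both lie in the dual cone, but a nonzero vector of the
  dual cone pairs positively with every interior point of \<open>C\<close>.\<close>

lemma L_eq_0_imp: "L v = 0 \<Longrightarrow> v = 0"
proof (rule ccontr)
  assume "L v = 0" "v \<noteq> 0"
  moreover from this have "L (- v) = 0" using linear_neg[OF linear_L] by simp
  moreover have "psd (0 :: real ^ 'l ^ 'l)" by (simp add: psd_def transpose_def vec_eq_iff)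
  ultimately have "v \<in> dual_cone C" "- v \<in> dual_cone C" by (auto intro: psd_imp_dual)
  moreover obtain t where "t \<in> interior C" using interior_nonempty by blast
  ultimately show False
    using interior_inner_dual_pos[of t C v] interior_inner_dual_pos[of t C "- v"] \<open>v \<noteq> 0\<close> by simp
qed

lemma linear_trace_mul_L: "linear (\<lambda>k. trace (A ** L k))"
  using linear_compose[OF linear_compose[OF linear_L linear_matrix_mul_right] linear_trace]
  by (simp add: o_def)

lemma linear_local_form_left: "linear (\<lambda>v. local_form x v k)"
  using linear_compose[OF linear_compose[OF linear_compose[OF linear_compose[OF linear_L
          linear_matrix_mul_right] linear_matrix_mul_left] linear_matrix_mul_left] linear_trace]
  by (simp add: o_def)

lemma continuous_on_L: "continuous_on S L"
  by (rule linear_continuous_on) (simp add: linear_L flip: linear_conv_bounded_linear)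

lemma continuous_local_form: "continuous_on S (\<lambda>v. local_form x v v)"
  unfolding trace_def matrix_matrix_mult_def
  by (simp, intro continuous_intros continuous_on_L)

text \<open>By \<open>pd_add_local_ball\<close>, the open unit ball of the local norm at
  \<open>x\<close> is a neighbourhood of \<open>x\<close> inside the set.\<close>

lemma open_pd: "open {x. pd (L x)}"
proof (subst open_subopen, rule ballI)
  fix x assume "x \<in> {x. pd (L x)}"
  then have x: "pd (L x)" by simp
  define T where "T = {k. local_form x (k - x) (k - x) < 1}"
  have "continuous_on UNIV (\<lambda>k. local_form x (k - x) (k - x))"
    by (rule continuous_on_compose2[OF continuous_local_form[of UNIV]]) (intro continuous_intros, simp)
  then have "open T" unfolding T_def by (intro open_Collect_less continuous_intros)
  moreover have "x \<in> T" using linear_0[OF linear_L] by (simp add: T_def trace_def)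
  moreover have "T \<subseteq> {x. pd (L x)}"
  proof
    fix k assume "k \<in> T"
    then have "pd (L x + L (k - x))"
      by (intro pd_add_local_ball x symmetric_L) (simp add: T_def)
    then show "k \<in> {x. pd (L x)}" by (simp flip: linear_add[OF linear_L])
  qed
  ultimately show "\<exists>T. open T \<and> x \<in> T \<and> T \<subseteq> {x. pd (L x)}" by blast
qed

lemma pd_imp_interior_dual: "pd (L x) \<Longrightarrow> x \<in> interior (dual_cone C)"
  by (rule interiorI[OF open_pd]) (auto intro: psd_imp_dual pd_imp_psd)

section \<open>Gradient and Hessian of the barrier\<close>

lemma GDERIV_log_det:
  assumes "pd (L x)"
  shows "GDERIV (\<lambda>x. - ln (det (L x))) x :> (\<chi> j. - trace (matrix_inv (L x) ** L (axis j 1)))"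
proof -
  have L': "(L has_derivative L) (at x)" by (rule linear_imp_has_derivative[OF linear_L])
  have inv: "invertible (L x)" and pos: "0 < det (L x)"
    using assms by (simp_all add: pd_imp_invertible pd_imp_det_pos)
  have "((\<lambda>x. det (L x)) has_derivative (\<lambda>h. det (L x) * trace (matrix_inv (L x) ** L h))) (at x)"
    by (rule has_derivative_compose[OF L' det_has_derivative[OF inv]])
  then have "((\<lambda>x. - ln (det (L x))) has_derivative
      (\<lambda>h. - (det (L x) * trace (matrix_inv (L x) ** L h) * inverse (det (L x))))) (at x)"
    using pos by (intro has_derivative_minus has_derivative_ln) auto
  moreover have "- (det (L x) * trace (matrix_inv (L x) ** L h) * inverse (det (L x)))
      = h \<bullet> (\<chi> j. - trace (matrix_inv (L x) ** L (axis j 1)))" for h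
  proof -
    have "trace (matrix_inv (L x) ** L h)
        = trace (matrix_inv (L x) ** L (\<Sum>j\<in>UNIV. h $ j *\<^sub>R axis j 1))"
      by (simp only: sum_scaleR_axis)
    also have "\<dots> = (\<Sum>j\<in>UNIV. h $ j * trace (matrix_inv (L x) ** L (axis j 1)))"
      by (simp add: linear_sum[OF linear_trace_mul_L] linear_cmul[OF linear_trace_mul_L])
    finally show ?thesis using pos by (simp add: inner_vec_def sum_negf)
  qed
  ultimately show ?thesis unfolding gderiv_def by (simp add: fun_eq_iff)
qed

lemma gradient_log_det:
  assumes "pd (L x)"
  shows "gradient (\<lambda>x. - ln (det (L x))) x = (\<chi> j. - trace (matrix_inv (L x) ** L (axis j 1)))"
  unfolding gradient_def
proof (rule the_equality)
  show "GDERIV (\<lambda>x. - ln (det (L x))) x :> (\<chi> j. - trace (matrix_inv (L x) ** L (axis j 1)))"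
    by (rule GDERIV_log_det[OF assms])
  fix D assume "GDERIV (\<lambda>x. - ln (det (L x))) x :> D"
  then have "(\<lambda>h. h \<bullet> D) = (\<lambda>h. h \<bullet> (\<chi> j. - trace (matrix_inv (L x) ** L (axis j 1))))"
    using GDERIV_log_det[OF assms] has_derivative_unique unfolding gderiv_def by blast
  then show "D = (\<chi> j. - trace (matrix_inv (L x) ** L (axis j 1)))"
    by (metis vector_eq_ldot)
qed

lemma hessian_log_det:
  assumes "pd (L x)"
  shows "hessian (\<lambda>x. - ln (det (L x))) x *v v = (\<chi> j. local_form x v (axis j 1))"
proof -
  let ?f = "\<lambda>x. - ln (det (L x))" and ?P = "matrix_inv (L x)"
  let ?g = "\<lambda>x. \<chi> j. - trace (matrix_inv (L x) ** L (axis j 1))"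
  have L': "(L has_derivative L) (at x)" by (rule linear_imp_has_derivative[OF linear_L])
  have P': "((\<lambda>x. matrix_inv (L x)) has_derivative (\<lambda>h. - (?P ** L h ** ?P))) (at x)"
    by (rule has_derivative_compose[OF L' matrix_inv_has_derivative[OF pd_imp_invertible[OF assms]]])
  have "((\<lambda>x. - trace (matrix_inv (L x) ** A)) has_derivative (\<lambda>h. trace (?P ** L h ** ?P ** A))) (at x)"
    for A
  proof -
    have "linear (\<lambda>B. - trace (B ** A))"
      using linear_compose_neg[OF linear_compose[OF linear_matrix_mul_left linear_trace]] by (simp add: o_def)
    from has_derivative_compose[OF P' linear_imp_has_derivative[OF this]]
    have "((\<lambda>x. - trace (matrix_inv (L x) ** A)) has_derivative (\<lambda>h. - trace (- (?P ** L h ** ?P) ** A))) (at x)" .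
    moreover have "- trace (- B ** A) = trace (B ** A)" for B :: "real ^ 'l ^ 'l"
      using linear_neg[OF linear_compose[OF linear_matrix_mul_left linear_trace], of A B] by (simp add: o_def)
    ultimately show ?thesis by simp
  qed
  then have "(?g has_derivative (\<lambda>h. \<chi> j. local_form x h (axis j 1))) (at x)"
    by (intro has_derivative_vec_lambda)
  \<comment> \<open>The formula for the gradient is available where \<open>L\<close> is positive
    definite; this set is open, so the derivative carries over.\<close>
  then have deriv: "(gradient ?f has_derivative (\<lambda>h. \<chi> j. local_form x h (axis j 1))) (at x)"
    by (rule has_derivative_transform_within_open[OF _ open_pd]) (use assms gradient_log_det in auto)
  have "hessian ?f x = matrix (\<lambda>h. \<chi> j. local_form x h (axis j 1))"
    unfolding hessian_def jacobian_def frechet_derivative_at[OF deriv, symmetric] ..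
  then show ?thesis
    using fun_cong[OF matrix_vector_mul(2)[OF has_derivative_linear[OF deriv]], of v] by (simp only:)
qed

lemma hessian_inner:
  assumes "pd (L x)"
  shows "(hessian (\<lambda>x. - ln (det (L x))) x *v v) \<bullet> k = local_form x v k"
proof -
  have "local_form x v k = local_form x v (\<Sum>j\<in>UNIV. k $ j *\<^sub>R axis j 1)"
    by (simp only: sum_scaleR_axis)
  also have "\<dots> = (\<Sum>j\<in>UNIV. k $ j * local_form x v (axis j 1))"
    by (simp add: linear_sum[OF linear_trace_mul_L] linear_cmul[OF linear_trace_mul_L])
  finally show ?thesis by (simp add: hessian_log_det[OF assms] inner_vec_def mult.commute)
qed

text \<open>A kernel vector \<open>v\<close> of the Hessian has local norm 0, so the form of
  \<open>L v\<close> vanishes identically; hence \<open>L v = 0\<close>.\<close>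

lemma invertible_hessian:
  assumes "pd (L x)"
  shows "invertible (hessian (\<lambda>x. - ln (det (L x))) x)"
  unfolding invertible_left_inverse matrix_left_invertible_ker
proof (intro allI impI)
  fix v assume "hessian (\<lambda>x. - ln (det (L x))) x *v v = 0"
  then have "local_form x v v = 0" using hessian_inner[OF assms, of v v] by simp
  then have "h \<bullet> (L v *v h) = 0" for h
    using quadratic_form_le_local_norm[OF assms symmetric_L[of v], of h] by simp
  moreover from this have "psd (L v)" using symmetric_L by (simp add: psd_def)
  ultimately have "L v *v h = 0" for h by (intro psd_zero_imp_kernel) auto
  then have "L v = 0" by (simp add: matrix_eq)
  then show "v = 0" by (rule L_eq_0_imp)
qed

text \<open>In the local norm at \<open>x\<close>, the point \<open>u = H(x)\<inverse> t\<close> is at most as far from \<open>x\<close> as \<open>x\<close> is from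
  \<open>y\<close> in the local norm at \<open>y\<close>, so it stays in the unit ball around \<open>x\<close>.\<close>

lemma certificate_near_center:
  assumes y: "pd (L y)" and center: "\<And>v. trace (matrix_inv (L y) ** L v) = t \<bullet> v"
    and near: "local_form y (x - y) (x - y) < 1"
  shows "pd (L x)" "matrix_inv (hessian (\<lambda>x. - ln (det (L x))) x) *v t \<in> dual_cone C"
proof -
  have "pd (L y + L (x - y))" by (rule pd_add_local_ball[OF y symmetric_L near])
  then show x: "pd (L x)" by (simp flip: linear_add[OF linear_L])
  let ?H = "hessian (\<lambda>x. - ln (det (L x))) x"
  define u where "u = matrix_inv ?H *v t"
  have Hu: "?H *v u = t"
    by (simp add: u_def matrix_vector_mul_assoc matrix_inv_right invertible_hessian x)
  define T where "T = local_form x (u - x) (u - x)"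
  have "T = (?H *v (u - x)) \<bullet> (u - x)" by (simp add: T_def hessian_inner[OF x])
  also have "\<dots> = t \<bullet> (u - x) - local_form x x (u - x)"
    by (simp add: matrix_vector_mult_diff_distrib Hu inner_diff_left hessian_inner[OF x])
  \<comment> \<open>This is \<open>H(x) x = - g(x)\<close>: the factor
    \<open>matrix_inv (L x) ** L x\<close> cancels. It makes \<open>T\<close> a difference of
    gradients at \<open>x\<close> and \<open>y\<close>.\<close>
  also have "local_form x x (u - x) = trace (matrix_inv (L x) ** L (u - x))"
    by (simp add: matrix_inv_left pd_imp_invertible[OF x])
  also have "t \<bullet> (u - x) = trace (matrix_inv (L y) ** L (u - x))" by (simp add: center)
  finally have T: "T = trace ((matrix_inv (L y) - matrix_inv (L x)) ** L (u - x))"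
    by (simp add: matrix_mul_diff_left trace_sub)
  have T0: "0 \<le> T"
    unfolding T_def by (intro trace_sandwich_nonneg pd_imp_psd pd_matrix_inv x symmetric_L)
  \<comment> \<open>\<open>T\<close> occurs on both sides, so the bound on the gradient change
    bounds \<open>T\<close> itself.\<close>
  have "T\<^sup>2 \<le> local_form y (x - y) (x - y) * T"
    using trace_matrix_inv_diff[OF x y symmetric_L[of "u - x"]]
    by (simp only: linear_diff[OF linear_L, symmetric] T[symmetric] T_def[symmetric])
  also have "\<dots> \<le> 1 * T" using near T0 by (intro mult_right_mono) simp_all
  finally have "T * T \<le> 1 * T" by (simp only: power2_eq_square)
  then have "T \<le> 1" using T0 by (cases "T = 0") (simp_all add: mult_le_cancel_right)
  then have "psd (L x + L (u - x))"
    by (intro psd_add_local_ball x symmetric_L) (simp add: T_def)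
  then have "psd (L u)" by (simp flip: linear_add[OF linear_L])
  then show "matrix_inv ?H *v t \<in> dual_cone C" using psd_imp_dual u_def by simp
qed

text \<open>Compactness of the slice yields the maximiser. Its first-order condition covers the
  directions orthogonal to \<open>t\<close>; in direction \<open>y\<close> both sides equal
  \<open>\<nu>\<close>, and together these directions span.\<close>

lemma center_exists:
  assumes t: "t \<in> interior C" and x0: "pd (L x0)"
  obtains y where "pd (L y)" "\<And>v. trace (matrix_inv (L y) ** L v) = t \<bullet> v"
proof -
  define \<nu> where "\<nu> = real CARD('l)"
  have \<nu>: "0 < \<nu>" by (simp add: \<nu>_def)
  \<comment> \<open>The slice is taken at height \<open>\<nu>\<close> because
    \<open>matrix_inv (L y) ** L y\<close> has trace \<open>\<nu>\<close>.\<close>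
  define K where "K = {x. psd (L x) \<and> t \<bullet> x = \<nu>}"
  obtain \<delta> where \<delta>: "0 < \<delta>" "\<And>x. x \<in> dual_cone C \<Longrightarrow> \<delta> * norm x \<le> t \<bullet> x"
    using interior_inner_dual_ge[OF t] by blast
  have "norm x \<le> \<nu> / \<delta>" if "x \<in> K" for x
    using \<delta>(2)[OF psd_imp_dual, of x] \<delta>(1) that by (simp add: K_def field_simps)
  then have "bounded K" by (rule boundedI)
  moreover have "K = (\<Inter>h. {x. 0 \<le> h \<bullet> (L x *v h)}) \<inter> {x. t \<bullet> x = \<nu>}"
    by (auto simp: K_def psd_def symmetric_L)
  moreover have "continuous_on UNIV (\<lambda>x. h \<bullet> (L x *v h))" for h
    unfolding matrix_vector_mult_def
    by (intro continuous_intros continuous_on_L)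
  moreover from this have "closed (\<Inter>h. {x. 0 \<le> h \<bullet> (L x *v h)})"
    by (intro closed_INT ballI closed_Collect_le continuous_on_const)
  moreover have "closed {x. t \<bullet> x = \<nu>}" by (intro closed_Collect_eq continuous_intros)
  ultimately have "compact K" by (simp add: compact_eq_bounded_closed closed_Int)
  have "L 0 = 0" using linear_L by (rule linear_0)
  have "x0 \<noteq> 0"
  proof
    assume "x0 = 0"
    with x0 \<open>L 0 = 0\<close> have "0 < (1 :: real ^ 'l) \<bullet> ((0 :: real ^ 'l ^ 'l) *v 1)"
      by (simp add: pd_def del: matrix_vector_mult_0)
    then show False by simp
  qed
  then have tx0: "0 < t \<bullet> x0"
    by (rule interior_inner_dual_pos[OF t psd_imp_dual[OF pd_imp_psd[OF x0]]])
  define x1 where "x1 = (\<nu> / (t \<bullet> x0)) *\<^sub>R x0"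
  have x1: "pd (L x1)"
    using x0 \<nu> tx0 by (simp add: x1_def linear_cmul[OF linear_L] pd_def transpose_scaleR
        flip: scaleR_matrix_vector_assoc)
  have "x1 \<in> K" using tx0 pd_imp_psd[OF x1] by (simp add: K_def x1_def)
  moreover have "continuous_on K (\<lambda>x. det (L x))"
    by (rule continuous_on_compose2[OF continuous_on_det continuous_on_L]) simp
  ultimately obtain y where y: "y \<in> K" "\<And>x. x \<in> K \<Longrightarrow> det (L x) \<le> det (L y)"
    using continuous_attains_sup[OF \<open>compact K\<close>] by (metis (no_types, lifting) empty_iff)
  have "0 < det (L y)" using y(2)[OF \<open>x1 \<in> K\<close>] pd_imp_det_pos[OF x1] by linarith
  have psdy: "psd (L y)" and ty: "t \<bullet> y = \<nu>" using y(1) by (simp_all add: K_def)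
  have inv: "invertible (L y)" using \<open>0 < det (L y)\<close> by (simp add: invertible_det_nz)
  \<comment> \<open>A zero of a psd form lies in the kernel, which invertibility makes
    trivial.\<close>
  have pdy: "pd (L y)"
  proof -
    have "h \<bullet> (L y *v h) \<noteq> 0" if "h \<noteq> 0" for h
      using psd_zero_imp_kernel[OF psdy, of h] inv that
      by (metis invertible_left_inverse matrix_left_invertible_ker)
    then show ?thesis using psdy by (auto simp: psd_def pd_def less_le)
  qed
  have trace_y: "trace (matrix_inv (L y) ** L y) = \<nu>"
    by (simp add: matrix_inv_left inv trace_I \<nu>_def)
  have perp: "trace (matrix_inv (L y) ** L v) = 0" if "t \<bullet> v = 0" for v
  proof -
    let ?\<phi> = "\<lambda>s. det (L (y + s *\<^sub>R v))"
    have "((\<lambda>s. L (y + s *\<^sub>R v)) has_derivative (\<lambda>s. L (s *\<^sub>R v))) (at 0)"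
      by (rule has_derivative_compose[OF _ linear_imp_has_derivative[OF linear_L]])
        (auto intro!: derivative_eq_intros)
    then have "(?\<phi> has_derivative (\<lambda>s. det (L y) * trace (matrix_inv (L y) ** L (s *\<^sub>R v)))) (at 0)"
      using has_derivative_compose[of "\<lambda>s. L (y + s *\<^sub>R v)" _ 0 UNIV det] det_has_derivative[OF inv]
      by simp
    then have "(?\<phi> has_real_derivative (det (L y) * trace (matrix_inv (L y) ** L v))) (at 0)"
      unfolding has_field_derivative_def
      by (rule has_derivative_eq_rhs) (simp add: fun_eq_iff linear_cmul[OF linear_trace_mul_L])
    moreover obtain r where r: "0 < r" "ball y r \<subseteq> {x. pd (L x)}"
      using open_pd pdy open_contains_ball by (metis mem_Collect_eq)
    \<comment> \<open>This radius keeps \<open>y + s *\<^sub>R v\<close> in the ball of positive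
      definite points; orthogonality of \<open>v\<close> to \<open>t\<close> keeps it in the
      slice.\<close>
    define \<rho> where "\<rho> = r / (norm v + 1)"
    have \<rho>: "0 < \<rho>" unfolding \<rho>_def using r(1) by (simp add: add_nonneg_pos)
    have "?\<phi> s \<le> ?\<phi> 0" if s: "\<bar>0 - s\<bar> < \<rho>" for s
    proof -
      have "\<bar>s\<bar> * norm v \<le> \<bar>s\<bar> * (norm v + 1)" by (intro mult_left_mono) auto
      also have "\<dots> < r" using s by (simp add: \<rho>_def pos_less_divide_eq add_nonneg_pos)
      finally have "y + s *\<^sub>R v \<in> ball y r" by (simp add: dist_norm)
      then have "pd (L (y + s *\<^sub>R v))" using r(2) by blast
      then have "y + s *\<^sub>R v \<in> K"
        using ty that \<open>t \<bullet> v = 0\<close> by (simp add: K_def pd_imp_psd inner_add_right)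
      then show ?thesis using y(2) by simp
    qed
    ultimately have "det (L y) * trace (matrix_inv (L y) ** L v) = 0"
      using DERIV_local_max[of ?\<phi> _ 0 \<rho>] \<rho> by blast
    then show ?thesis using \<open>0 < det (L y)\<close> by simp
  qed
  have "trace (matrix_inv (L y) ** L v) = t \<bullet> v" for v
  proof -
    \<comment> \<open>Subtracting the right multiple of \<open>y\<close> leaves a direction
      orthogonal to \<open>t\<close>.\<close>
    have "trace (matrix_inv (L y) ** L (v - ((t \<bullet> v) / \<nu>) *\<^sub>R y)) = 0"
      using \<nu> ty by (intro perp) (simp add: inner_diff_right)
    then show ?thesis
      using \<nu> by (simp add: linear_diff[OF linear_trace_mul_L]
          linear_cmul[OF linear_trace_mul_L] trace_y)
  qed
  with pdy show thesis by (rule that)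
qed

text \<open>The coefficients \<open>c\<close> expand \<open>x\<close> in the \<open>v i\<close>
  through \<open>u = matrix_inv M *v x\<close>. Local inner products of \<open>v i\<close> and
  \<open>v j\<close> are at most \<open>(t \<bullet> v i) * (t \<bullet> v j)\<close>, so the double
  sum is bounded by a square. Cauchy-Schwarz with weights \<open>\<alpha>\<close> gives
  \<open>(u \<bullet> (M *v u)) * (t \<bullet> (M *v t))\<close>, and the extreme eigenvalues of
  \<open>M\<close> produce the condition number.\<close>

lemma local_form_le_cond:
  fixes v :: "'i \<Rightarrow> real ^ 'u"
  assumes y: "pd (L y)" and center: "\<And>v. trace (matrix_inv (L y) ** L v) = t \<bullet> v"
    and psd: "\<And>i. i \<in> I \<Longrightarrow> psd (L (v i))" and \<alpha>: "\<And>i. i \<in> I \<Longrightarrow> 0 < \<alpha> i"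
    and M: "M = (\<Sum>i\<in>I. \<alpha> i *\<^sub>R outer (v i))" and pdM: "pd M"
  shows "local_form y x x \<le> cond M * (t \<bullet> t) * (x \<bullet> x)"
proof -
  let ?Q = "matrix_inv (L y)"
  define u where "u = matrix_inv M *v x"
  define c where "c i = \<alpha> i * (v i \<bullet> u)" for i
  have symM: "transpose M = M" using pdM by (simp add: pd_def)
  have M_mult: "M *v k = (\<Sum>i\<in>I. (\<alpha> i * (v i \<bullet> k)) *\<^sub>R v i)" for k
    by (simp add: M sum_matrix_vector_mult outer_mult_vector flip: scaleR_matrix_vector_assoc)
  have quadM: "k \<bullet> (M *v k) = (\<Sum>i\<in>I. \<alpha> i * (v i \<bullet> k)\<^sup>2)" for k
    by (simp add: M_mult inner_sum_right power2_eq_square inner_commute mult_ac)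
  have Mu: "M *v u = x"
    by (simp add: u_def matrix_vector_mul_assoc matrix_inv_right pd_imp_invertible pdM)
  then have x: "x = (\<Sum>i\<in>I. c i *\<^sub>R v i)" by (simp add: M_mult c_def)
  \<comment> \<open>Taking \<open>L y\<close> itself as one factor of the trace inequality gives
    \<open>0 \<le> CARD('l) * (t \<bullet> v i)\<close>.\<close>
  have tv: "0 \<le> t \<bullet> v i" if "i \<in> I" for i
    using trace_sandwich_le_mult_trace[OF pd_imp_psd[OF pd_matrix_inv[OF y]] pd_imp_psd[OF y] psd[OF that]]
    by (simp add: center matrix_inv_left pd_imp_invertible y trace_I zero_le_mult_iff)
      (smt (verit) card_gt_0_iff finite of_nat_0_less_iff zero_less_mult_iff UNIV_not_empty)
  have "local_form y x k = (\<Sum>i\<in>I. c i * local_form y (v i) k)" for k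
    by (subst x) (simp add: linear_sum[OF linear_local_form_left] linear_cmul[OF linear_local_form_left])
  moreover have "local_form y k x = (\<Sum>j\<in>I. c j * local_form y k (v j))" for k
    by (subst x) (simp add: linear_sum[OF linear_trace_mul_L] linear_cmul[OF linear_trace_mul_L])
  then have "(\<Sum>i\<in>I. c i * local_form y (v i) x)
      = (\<Sum>i\<in>I. c i * (\<Sum>j\<in>I. c j * local_form y (v i) (v j)))" by simp
  ultimately have "local_form y x x = (\<Sum>i\<in>I. \<Sum>j\<in>I. c i * c j * local_form y (v i) (v j))"
    by (simp only: sum_distrib_left mult.assoc)
  also have "\<dots> \<le> (\<Sum>i\<in>I. \<Sum>j\<in>I. (\<bar>c i\<bar> * (t \<bullet> v i)) * (\<bar>c j\<bar> * (t \<bullet> v j)))"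
  proof (intro sum_mono)
    fix i j assume "i \<in> I" "j \<in> I"
    then have "\<bar>local_form y (v i) (v j)\<bar> \<le> (t \<bullet> v i) * (t \<bullet> v j)"
      using trace_sandwich_le_mult_trace[OF pd_imp_psd[OF pd_matrix_inv[OF y]] psd psd]
      by (simp add: center)
    then have "\<bar>c i * c j * local_form y (v i) (v j)\<bar> \<le> \<bar>c i * c j\<bar> * ((t \<bullet> v i) * (t \<bullet> v j))"
      unfolding abs_mult[of "c i * c j" "local_form y (v i) (v j)"] by (intro mult_left_mono) auto
    then show "c i * c j * local_form y (v i) (v j) \<le> (\<bar>c i\<bar> * (t \<bullet> v i)) * (\<bar>c j\<bar> * (t \<bullet> v j))"
      using abs_ge_self[of "c i * c j * local_form y (v i) (v j)"]
      unfolding abs_mult[of "c i" "c j"] by (simp only: mult_ac)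
  qed
  \<comment> \<open>Each weight is split into two square roots, one for each Cauchy-Schwarz
    factor.\<close>
  also have "\<dots> = (\<Sum>i\<in>I. (sqrt (\<alpha> i) * \<bar>v i \<bullet> u\<bar>) * (sqrt (\<alpha> i) * (t \<bullet> v i)))\<^sup>2"
  proof -
    have "(sqrt (\<alpha> i) * \<bar>v i \<bullet> u\<bar>) * (sqrt (\<alpha> i) * (t \<bullet> v i)) = \<bar>c i\<bar> * (t \<bullet> v i)" if "i \<in> I" for i
    proof -
      have "sqrt (\<alpha> i) * sqrt (\<alpha> i) = \<alpha> i" using \<alpha>[OF that] by simp
      then show ?thesis using \<alpha>[OF that] by (simp add: c_def abs_mult mult_ac)
    qed
    then have "(\<Sum>i\<in>I. (sqrt (\<alpha> i) * \<bar>v i \<bullet> u\<bar>) * (sqrt (\<alpha> i) * (t \<bullet> v i))) = (\<Sum>i\<in>I. \<bar>c i\<bar> * (t \<bullet> v i))"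
      by (intro sum.cong refl)
    then show ?thesis by (simp only: power2_eq_square sum_product)
  qed
  also have "\<dots> \<le> (\<Sum>i\<in>I. (sqrt (\<alpha> i) * \<bar>v i \<bullet> u\<bar>)\<^sup>2) * (\<Sum>i\<in>I. (sqrt (\<alpha> i) * (t \<bullet> v i))\<^sup>2)"
    by (rule Cauchy_Schwarz_ineq_sum)
  also have "\<dots> = (u \<bullet> (M *v u)) * (t \<bullet> (M *v t))"
    using \<alpha> by (simp add: quadM power_mult_distrib less_imp_le inner_commute cong: sum.cong)
  also have "\<dots> \<le> ((x \<bullet> x) / Min (eigenvalues M)) * (Max (eigenvalues M) * (t \<bullet> t))"
  proof (rule mult_mono)
    show "u \<bullet> (M *v u) \<le> (x \<bullet> x) / Min (eigenvalues M)"
      using quadratic_form_matrix_inv_le[OF pdM, of x] by (simp add: Mu inner_commute flip: u_def)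
    show "0 \<le> t \<bullet> (M *v t)" using pd_imp_psd[OF pdM] by (simp add: psd_def)
  qed (use quadratic_form_le_Max_eigenvalues[OF symM] pd_imp_Min_eigenvalues_pos[OF pdM] in auto)
  also have "\<dots> = cond M * (t \<bullet> t) * (x \<bullet> x)" by (simp add: cond_def)
  finally show ?thesis .
qed

end

section \<open>Rounding the scaled maximiser to an integer vector\<close>

lemma cond_ge_1:
  assumes "pd M"
  shows "1 \<le> cond M"
proof -
  have sym: "transpose M = M" using assms by (simp add: pd_def)
  have "Min (eigenvalues M) \<le> Max (eigenvalues M)"
    using eigenvalues_nonempty[OF sym] eigenvalues_finite[OF sym] by (meson Max_in Min_le)
  then show ?thesis using pd_imp_Min_eigenvalues_pos[OF assms] by (simp add: cond_def)
qed

lemma infnorm_le_cart: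
  fixes v :: "real ^ 'n::finite"
  assumes "\<And>j. \<bar>v $ j\<bar> \<le> b"
  shows "infnorm v \<le> b"
  unfolding infnorm_cart by (rule cSup_least) (use assms in auto)

lemma inner_self_le_cart:
  fixes v :: "real ^ 'n::finite"
  assumes "\<And>j. \<bar>v $ j\<bar> \<le> b"
  shows "v \<bullet> v \<le> real CARD('n) * b\<^sup>2"
proof -
  have "v \<bullet> v \<le> (\<Sum>j\<in>(UNIV :: 'n set). b\<^sup>2)"
    unfolding inner_vec_def
  proof (rule sum_mono)
    fix j
    have "\<bar>v $ j\<bar>\<^sup>2 \<le> b\<^sup>2" by (intro power_mono assms) simp
    then show "v $ j \<bullet> v $ j \<le> b\<^sup>2" by (simp add: power2_eq_square)
  qed
  then show ?thesis by simp
qed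

context log_det_barrier
begin

text \<open>The trace identity at \<open>y\<close> gives \<open>t \<bullet> y = CARD('l)\<close>;
  pairing \<open>y\<close> with \<open>t - \<epsilon> *\<^sub>R e\<close> bounds
  \<open>e \<bullet> y\<close>, and \<open>k1\<close> converts this into a maximum norm.\<close>

lemma center_norm_le:
  assumes e: "e \<in> interior C" and y: "pd (L y)"
    and center: "\<And>v. trace (matrix_inv (L y) ** L v) = t \<bullet> v"
    and te: "t - \<epsilon> *\<^sub>R e \<in> C" and \<epsilon>: "0 < \<epsilon>"
  shows "infnorm y \<le> real CARD('l) / (k1 C e * \<epsilon>)"
proof -
  have yd: "y \<in> dual_cone C" by (intro psd_imp_dual pd_imp_psd y)
  have ty: "t \<bullet> y = real CARD('l)"
    using center[of y] by (simp add: matrix_inv_left pd_imp_invertible y trace_I)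
  then have "y \<noteq> 0" by auto
  have "0 \<le> (t - \<epsilon> *\<^sub>R e) \<bullet> y" using te yd by (simp add: dual_cone_def)
  then have "e \<bullet> y \<le> real CARD('l) / \<epsilon>" using \<epsilon> ty by (simp add: inner_diff_left field_simps)
  moreover have "k1 C e * infnorm y \<le> e \<bullet> y" by (rule k1_le[OF e yd \<open>y \<noteq> 0\<close> yd])
  ultimately have "k1 C e * infnorm y \<le> real CARD('l) / \<epsilon>" by linarith
  then show ?thesis
    using k1_pos[OF e yd \<open>y \<noteq> 0\<close>] \<epsilon> by (simp add: field_simps)
qed

text \<open>Coordinate errors of at most 1/2 have squared Euclidean norm at most
  \<open>CARD('u) / 4\<close>, hence local norm at most \<open>R / 3\<close> at \<open>y\<close> and
  \<open>R / (3 * N)\<close> at \<open>N *\<^sub>R y\<close>. The factor 3/2 in \<open>R\<close>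
  thus leaves a local radius of 1/3.\<close>

lemma integer_certificate_exists:
  fixes v :: "'i \<Rightarrow> real ^ 'u"
  assumes t: "t \<in> interior C" and e: "e \<in> interior C"
    and te: "t - \<epsilon> *\<^sub>R e \<in> C" and \<epsilon>: "0 < \<epsilon>" and x0: "pd (L x0)"
    and psd: "\<And>i. i \<in> I \<Longrightarrow> psd (L (v i))" and \<alpha>: "\<And>i. i \<in> I \<Longrightarrow> 0 < \<alpha> i"
    and M: "M = (\<Sum>i\<in>I. \<alpha> i *\<^sub>R outer (v i))" and pdM: "pd M"
  shows "\<exists>x. (\<forall>j. x $ j \<in> \<int>) \<and> pd (L x) \<and>
    matrix_inv (hessian (\<lambda>x. - ln (det (L x))) x) *v t \<in> dual_cone C \<and>
    infnorm x \<le> 1 / 2 + of_int \<lceil>3 / 2 * sqrt (real CARD('u) * cond M) * norm t\<rceil>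
      * (real CARD('l) / (k1 C e * \<epsilon>))"
proof -
  obtain y where y: "pd (L y)" and center: "\<And>v. trace (matrix_inv (L y) ** L v) = t \<bullet> v"
    using center_exists[OF t x0] by blast
  define R where "R = 3 / 2 * sqrt (real CARD('u) * cond M) * norm t"
  define N where "N = real_of_int \<lceil>R\<rceil>"
  have "t \<noteq> 0"
  proof
    assume "t = 0"
    then have "real CARD('l) = 0"
      using center[of y] by (simp add: matrix_inv_left pd_imp_invertible y trace_I)
    then show False by simp
  qed
  moreover have cond: "1 \<le> cond M" by (rule cond_ge_1[OF pdM])
  ultimately have "0 < R" by (simp add: R_def)
  moreover have "R \<le> N" by (simp add: N_def)
  ultimately have N: "0 < N" by linarith
  define x :: "real ^ 'u" where "x = (\<chi> j. of_int (round (N * y $ j)))"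
  have diff: "\<bar>(x - N *\<^sub>R y) $ j\<bar> \<le> 1 / 2" for j
    using of_int_round_abs_le[of "N * y $ j"] by (simp add: x_def)
  have LN: "L (N *\<^sub>R y) = N *\<^sub>R L y" by (rule linear_cmul[OF linear_L])
  have inv: "matrix_inv (L (N *\<^sub>R y)) = (1 / N) *\<^sub>R matrix_inv (L y)"
    unfolding LN using N by (intro matrix_inv_scaleR pd_imp_invertible y) simp
  have pdN: "pd (L (N *\<^sub>R y))" unfolding LN by (rule pd_scaleR[OF y N])
  \<comment> \<open>\<open>N *\<^sub>R y\<close> is the center belonging to \<open>t / N\<close>,
    since the inverse scales by \<open>1 / N\<close>.\<close>
  have centerN: "trace (matrix_inv (L (N *\<^sub>R y)) ** L k) = ((1 / N) *\<^sub>R t) \<bullet> k" for k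
    unfolding inv scalar_matrix_assoc[symmetric] trace_scaleR center by simp
  have "local_form (N *\<^sub>R y) k k = local_form y k k / N\<^sup>2" for k
    unfolding inv by (simp add: matrix_scalar_ac trace_scaleR power2_eq_square flip: scalar_matrix_assoc)
  then have "local_form (N *\<^sub>R y) (x - N *\<^sub>R y) (x - N *\<^sub>R y)
      = local_form y (x - N *\<^sub>R y) (x - N *\<^sub>R y) / N\<^sup>2" .
  also have "\<dots> \<le> (cond M * (t \<bullet> t) * ((x - N *\<^sub>R y) \<bullet> (x - N *\<^sub>R y))) / N\<^sup>2"
    by (intro divide_right_mono local_form_le_cond[OF y center psd \<alpha> M pdM]) simp_all
  also have "\<dots> \<le> (cond M * (t \<bullet> t) * (real CARD('u) * (1 / 2)\<^sup>2)) / N\<^sup>2"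
    using cond by (intro divide_right_mono mult_left_mono inner_self_le_cart diff) auto
  also have "\<dots> = (R\<^sup>2 / 9) / N\<^sup>2"
    using cond by (simp add: R_def power_mult_distrib power2_norm_eq_inner power_divide)
  also have "\<dots> \<le> (N\<^sup>2 / 9) / N\<^sup>2"
    using \<open>0 < R\<close> \<open>R \<le> N\<close> by (intro divide_right_mono power_mono) auto
  also have "\<dots> < 1" using N by simp
  finally have near: "local_form (N *\<^sub>R y) (x - N *\<^sub>R y) (x - N *\<^sub>R y) < 1" .
  let ?H = "hessian (\<lambda>x. - ln (det (L x))) x"
  have "matrix_inv ?H *v ((1 / N) *\<^sub>R t) \<in> dual_cone C"
    by (rule certificate_near_center(2)[OF pdN centerN near])
  \<comment> \<open>The condition for \<open>t / N\<close> passes to \<open>t\<close>, as the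
    inverse Hessian acts linearly and the dual cone is closed under nonnegative scaling.\<close>
  then have "N *\<^sub>R (matrix_inv ?H *v ((1 / N) *\<^sub>R t)) \<in> dual_cone C"
    using N by (intro dual_cone_scaleR) auto
  then have "matrix_inv ?H *v t \<in> dual_cone C" using N by (simp add: matrix_vector_mult_scaleR)
  moreover have "pd (L x)" by (rule certificate_near_center(1)[OF pdN centerN near])
  moreover have "infnorm x \<le> 1 / 2 + N * (real CARD('l) / (k1 C e * \<epsilon>))"
  proof -
    have "infnorm x \<le> infnorm (x - N *\<^sub>R y) + infnorm (N *\<^sub>R y)"
      using infnorm_triangle[of "x - N *\<^sub>R y" "N *\<^sub>R y"] by simp
    also have "infnorm (x - N *\<^sub>R y) \<le> 1 / 2" by (rule infnorm_le_cart[OF diff])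
    also have "infnorm (N *\<^sub>R y) \<le> N * (real CARD('l) / (k1 C e * \<epsilon>))"
      unfolding infnorm_mul using N center_norm_le[OF e y center te \<epsilon>]
      by (intro mult_mono) (simp_all add: infnorm_pos_le)
    finally show ?thesis by simp
  qed
  moreover have "\<forall>j. x $ j \<in> \<int>" by (simp add: x_def)
  ultimately show ?thesis unfolding N_def R_def by blast
qed

end

section \<open>Weighted sums of squares\<close>

locale weighted_sos_data =
  fixes w :: "'m::finite \<Rightarrow> 'n::finite rpoly" and d :: "'m \<Rightarrow> nat"
    and q :: "'u::finite \<Rightarrow> 'n rpoly" and blk :: "'l::finite \<Rightarrow> 'm" and p :: "'l \<Rightarrow> 'n rpoly"
    and I :: "'i set" and z :: "'i \<Rightarrow> real ^ 'n"
  assumes w_nonzero: "\<And>i. w i \<noteq> 0"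
    and q_basis: "ordered_basis_on UNIV q (weighted_space w d)"
    and p_basis: "\<And>i. ordered_basis_on {a. blk a = i} p (polys_le (d i))"
    and finite_I: "finite I"
    and z_mem: "z ` I \<subseteq> semialg w"
    and z_unisolvent: "unisolvent (z ` I) (weighted_space w d)"
begin

lemma inner_eval_vec: "c \<bullet> eval_vec q x = eval (\<Sum>j\<in>UNIV. c $ j *\<^sub>R q j) x"
  by (simp add: inner_vec_def eval_vec_def eval_sum eval_scaleR)

lemma weighted_space_eq_span: "weighted_space w d = span (range q)"
  using q_basis by (simp add: ordered_basis_on_def)

lemma eq_0_if_vanishing:
  assumes "f \<in> weighted_space w d" "\<And>k. k \<in> I \<Longrightarrow> eval f (z k) = 0"
  shows "f = 0"
proof -
  have "0 \<in> weighted_space w d" by (simp add: weighted_space_eq_span span_zero)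
  then show ?thesis using z_unisolvent assms by (auto simp: unisolvent_def)
qed

text \<open>\<open>c\<close> is the coefficient vector of a polynomial in the weighted space that
  vanishes at all nodes.\<close>

lemma eval_vec_orthogonal_imp_0:
  assumes "\<And>k. k \<in> I \<Longrightarrow> eval_vec q (z k) \<bullet> c = 0"
  shows "c = 0"
proof -
  have "(\<Sum>j\<in>UNIV. c $ j *\<^sub>R q j) \<in> weighted_space w d"
    unfolding weighted_space_eq_span by (intro span_sum span_scale span_base rangeI)
  then have "(\<Sum>j\<in>UNIV. c $ j *\<^sub>R q j) = 0"
    by (rule eq_0_if_vanishing) (use assms in \<open>simp add: inner_commute flip: inner_eval_vec\<close>)
  then have "c $ j = 0" for j
    using ordered_basis_sum_eq_0[OF q_basis, of "\<lambda>j. c $ j" j] by simp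
  then show ?thesis by (simp add: vec_eq_iff)
qed

text \<open>The form at \<open>h\<close> is the weighted sum of the squared node values of the
  polynomial with coefficients \<open>h\<close>; unisolvence prevents all of them from vanishing
  when \<open>h\<close> is nonzero.\<close>

lemma pd_sum_outer_eval_vec:
  assumes "\<And>k. k \<in> I \<Longrightarrow> 0 < \<alpha> k"
  shows "pd (\<Sum>k\<in>I. \<alpha> k *\<^sub>R outer (eval_vec q (z k)))" (is "pd ?M")
proof -
  have quad: "h \<bullet> (?M *v h) = (\<Sum>k\<in>I. \<alpha> k * (eval_vec q (z k) \<bullet> h)\<^sup>2)" for h
    by (simp add: sum_matrix_vector_mult outer_mult_vector inner_sum_right power2_eq_square
        inner_commute mult.assoc flip: scaleR_matrix_vector_assoc)
  have nonneg: "0 \<le> \<alpha> k * (eval_vec q (z k) \<bullet> h)\<^sup>2" if "k \<in> I" for h k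
    using assms[OF that] by simp
  have "0 < h \<bullet> (?M *v h)" if "h \<noteq> 0" for h
  proof -
    obtain k where k: "k \<in> I" "eval_vec q (z k) \<bullet> h \<noteq> 0"
      using eval_vec_orthogonal_imp_0 \<open>h \<noteq> 0\<close> by blast
    then have "0 < \<alpha> k * (eval_vec q (z k) \<bullet> h)\<^sup>2" using assms by simp
    then show ?thesis unfolding quad using k(1) nonneg finite_I by (intro sum_pos2[of I k])
  qed
  moreover have "transpose ?M = ?M" by (simp add: transpose_sum transpose_scaleR)
  ultimately show ?thesis by (simp add: pd_def)
qed

text \<open>Unit weights give an invertible \<open>?M\<close>, and applying it to
  \<open>matrix_inv ?M *v x\<close> is the expansion. Linear maps are thereby determined by their
  values at evaluation vectors.\<close>

lemma eval_vec_spanning: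
  obtains c where "x = (\<Sum>k\<in>I. c k *\<^sub>R eval_vec q (z k))"
proof -
  let ?M = "\<Sum>k\<in>I. 1 *\<^sub>R outer (eval_vec q (z k))"
  have "pd ?M" by (rule pd_sum_outer_eval_vec) simp
  then have "?M *v (matrix_inv ?M *v x) = x"
    by (simp add: matrix_vector_mul_assoc matrix_inv_right pd_imp_invertible)
  then have "x = (\<Sum>k\<in>I. (eval_vec q (z k) \<bullet> (matrix_inv ?M *v x)) *\<^sub>R eval_vec q (z k))"
    by (simp add: sum_matrix_vector_mult outer_mult_vector)
  then show thesis by (rule that)
qed

text \<open>This is \<open>p\<^sub>i(x)\<close> padded by zeros, so that its outer product has the
  zero pattern of \<open>Lambda_block\<close>.\<close>

definition block_vec :: "'m \<Rightarrow> real ^ 'n \<Rightarrow> real ^ 'l" where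
  "block_vec i x = (\<chi> a. if blk a = i then eval (p a) x else 0)"

text \<open>Coordinates of the products \<open>w i * (p a * p b)\<close> in the basis
  \<open>q\<close> supply the entries of such a map, and spanning by evaluation vectors makes it
  unique. This justifies the \<open>THE\<close> in the definition.\<close>

lemma Lambda_block:
  "linear (Lambda_block w q blk p i) \<and>
    (\<forall>x. Lambda_block w q blk p i (eval_vec q x) = eval (w i) x *\<^sub>R outer (block_vec i x))"
proof -
  have rhs: "(\<chi> a b. if blk a = i \<and> blk b = i then eval (w i) x * eval (p a) x * eval (p b) x else 0)
      = eval (w i) x *\<^sub>R outer (block_vec i x)" for x
    by (simp add: vec_eq_iff outer_def block_vec_def)
  let ?P = "\<lambda>L. linear L \<and> (\<forall>x. L (eval_vec q x) = eval (w i) x *\<^sub>R outer (block_vec i x))"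
  have "\<exists>c. w i * (p a * p b) = (\<Sum>j\<in>UNIV. c j *\<^sub>R q j)" if "blk a = i" "blk b = i" for a b
  proof -
    have "p a \<in> polys_le (d i)" "p b \<in> polys_le (d i)"
      using ordered_basis_subset[OF p_basis[of i]] that by blast+
    then have "w i * (p a * p b) \<in> weighted_space w d" by (rule weighted_space_mult)
    then show ?thesis using ordered_basis_coordinates[OF q_basis finite] by metis
  qed
  then obtain c where c: "\<And>a b. blk a = i \<Longrightarrow> blk b = i \<Longrightarrow> w i * (p a * p b) = (\<Sum>j\<in>UNIV. c a b j *\<^sub>R q j)"
    by metis
  have "?P (\<lambda>x. \<chi> a b. if blk a = i \<and> blk b = i then (\<chi> j. c a b j) \<bullet> x else 0)"
  proof
    show "linear (\<lambda>x. \<chi> a b. if blk a = i \<and> blk b = i then (\<chi> j. c a b j) \<bullet> x else 0)"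
      by (rule linearI) (simp_all add: vec_eq_iff inner_add_right)
    show "\<forall>x. (\<chi> a b. if blk a = i \<and> blk b = i then (\<chi> j. c a b j) \<bullet> eval_vec q x else 0)
        = eval (w i) x *\<^sub>R outer (block_vec i x)"
      unfolding rhs[symmetric] by (simp add: vec_eq_iff inner_eval_vec c[symmetric] eval_mult mult.assoc)
  qed
  moreover have "L = L'" if "?P L" "?P L'" for L L'
  proof
    fix x
    obtain c where x: "x = (\<Sum>k\<in>I. c k *\<^sub>R eval_vec q (z k))" by (rule eval_vec_spanning)
    show "L x = L' x" using that by (simp add: x linear_sum linear_cmul)
  qed
  ultimately have "\<exists>!L. ?P L" by blast
  from theI'[OF this] show ?thesis unfolding Lambda_block_def rhs .
qed

section \<open>\<Lambda> on evaluation vectors and membership in the dual cone\<close>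

lemma linear_Lambda: "linear (Lambda w q blk p)"
  unfolding Lambda_def by (intro linear_compose_sum ballI) (use Lambda_block in blast)

lemma Lambda_eval_vec:
  "Lambda w q blk p (eval_vec q x) = (\<Sum>i\<in>UNIV. eval (w i) x *\<^sub>R outer (block_vec i x))"
  unfolding Lambda_def using Lambda_block by simp

lemma symmetric_Lambda: "transpose (Lambda w q blk p x) = Lambda w q blk p x"
proof -
  obtain c where "x = (\<Sum>k\<in>I. c k *\<^sub>R eval_vec q (z k))" by (rule eval_vec_spanning)
  then show ?thesis
    by (simp add: linear_sum[OF linear_Lambda] linear_cmul[OF linear_Lambda] Lambda_eval_vec
        transpose_sum transpose_scaleR)
qed

lemma Lambda_eval_vec_quadratic_form:
  "h \<bullet> (Lambda w q blk p (eval_vec q x) *v h) = (\<Sum>i\<in>UNIV. eval (w i) x * (block_vec i x \<bullet> h)\<^sup>2)"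
  by (simp add: Lambda_eval_vec sum_matrix_vector_mult outer_mult_vector inner_sum_right
      power2_eq_square inner_commute mult.assoc flip: scaleR_matrix_vector_assoc)

lemma block_vec_inner: "block_vec i x \<bullet> h = eval (\<Sum>a | blk a = i. h $ a *\<^sub>R p a) x"
proof -
  have "block_vec i x \<bullet> h = (\<Sum>a | blk a = i. eval (p a) x * h $ a)"
    by (simp add: inner_vec_def block_vec_def if_distrib if_distribR sum.If_cases Int_def cong: if_cong)
  then show ?thesis by (simp add: eval_sum eval_scaleR mult.commute)
qed

lemma psd_Lambda_eval_vec:
  assumes "x \<in> semialg w"
  shows "psd (Lambda w q blk p (eval_vec q x))"
  using assms
  by (auto simp: psd_def symmetric_Lambda Lambda_eval_vec_quadratic_form semialg_def intro!: sum_nonneg)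

text \<open>A zero of the form forces \<open>w i * (r * r)\<close> to vanish at every node, with
  \<open>r\<close> the polynomial whose coefficients are block \<open>i\<close> of \<open>h\<close>.
  Unisolvence makes it the zero polynomial, and absence of zero divisors gives \<open>r = 0\<close>.
  This supplies the positive definite point for \<open>center_exists\<close>.\<close>

lemma pd_Lambda_sum_eval_vec: "pd (Lambda w q blk p (\<Sum>k\<in>I. eval_vec q (z k)))"
proof -
  have quad: "h \<bullet> (Lambda w q blk p (\<Sum>k\<in>I. eval_vec q (z k)) *v h)
      = (\<Sum>k\<in>I. \<Sum>i\<in>UNIV. eval (w i) (z k) * (block_vec i (z k) \<bullet> h)\<^sup>2)" for h
    by (simp add: linear_sum[OF linear_Lambda] sum_matrix_vector_mult inner_sum_right
        Lambda_eval_vec_quadratic_form)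
  have nonneg: "0 \<le> eval (w i) (z k) * (block_vec i (z k) \<bullet> h)\<^sup>2" if "k \<in> I" for i k h
    using z_mem that by (auto simp: semialg_def)
  have "0 < h \<bullet> (Lambda w q blk p (\<Sum>k\<in>I. eval_vec q (z k)) *v h)" if "h \<noteq> 0" for h
  proof (rule ccontr)
    assume "\<not> 0 < h \<bullet> (Lambda w q blk p (\<Sum>k\<in>I. eval_vec q (z k)) *v h)"
    then have "(\<Sum>k\<in>I. \<Sum>i\<in>UNIV. eval (w i) (z k) * (block_vec i (z k) \<bullet> h)\<^sup>2) \<le> 0"
      unfolding quad by simp
    moreover have "0 \<le> (\<Sum>k\<in>I. \<Sum>i\<in>UNIV. eval (w i) (z k) * (block_vec i (z k) \<bullet> h)\<^sup>2)"
      by (intro sum_nonneg nonneg)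
    ultimately have sum_zero: "(\<Sum>k\<in>I. \<Sum>i\<in>UNIV. eval (w i) (z k) * (block_vec i (z k) \<bullet> h)\<^sup>2) = 0"
      by (rule antisym)
    have zero: "eval (w i) (z k) * (block_vec i (z k) \<bullet> h)\<^sup>2 = 0" if k: "k \<in> I" for i k
    proof -
      have "(\<Sum>i\<in>UNIV. eval (w i) (z k) * (block_vec i (z k) \<bullet> h)\<^sup>2) = 0"
        by (rule sum_nonneg_0[OF finite_I _ sum_zero k]) (intro sum_nonneg nonneg)
      from sum_nonneg_0[OF finite _ this UNIV_I] show ?thesis using nonneg[OF k] by blast
    qed
    have "h $ a = 0" for a
    proof -
      let ?i = "blk a"
      define r where "r = (\<Sum>b | blk b = ?i. h $ b *\<^sub>R p b)"
      have r_mem: "r \<in> polys_le (d ?i)"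
      proof -
        have "polys_le (d ?i) = span (p ` {b. blk b = ?i})"
          using p_basis[of ?i] by (simp add: ordered_basis_on_def)
        then show ?thesis
          unfolding r_def by (simp only:) (intro span_sum span_scale span_base imageI)
      qed
      have "w ?i * (r * r) \<in> weighted_space w d" by (intro weighted_space_mult r_mem)
      then have "w ?i * (r * r) = 0"
        by (rule eq_0_if_vanishing)
          (use zero[of _ ?i] in \<open>simp add: eval_mult block_vec_inner r_def power2_eq_square\<close>)
      then have "eval (w ?i) x * eval (r * r) x = 0" for x by (metis eval_mult eval_0)
      then have "r * r = 0" by (rule eval_mult_eq_zero[OF _ w_nonzero])
      then have "eval r x * eval r x = 0" for x by (metis eval_mult eval_0)
      then have "r = 0" using eval_mult_eq_zero[of r r] by blast
      then show "h $ a = 0"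
        using ordered_basis_sum_eq_0[OF p_basis[of ?i], of "\<lambda>b. h $ b" a] by (simp add: r_def)
    qed
    then show False using \<open>h \<noteq> 0\<close> by (simp add: vec_eq_iff)
  qed
  then show ?thesis by (simp add: pd_def symmetric_Lambda)
qed

text \<open>Writing \<open>y\<close> through evaluation vectors turns its pairing with a polynomial
  into a linear combination of node values. For a weighted square this is the form of
  \<open>\<Lambda>(y)\<close> at the coefficients of the squared polynomial; sums preserve the
  sign.\<close>

lemma psd_Lambda_imp_dual:
  assumes "psd (Lambda w q blk p y)"
  shows "y \<in> dual_cone (Sig w d q)"
proof -
  obtain c where y: "y = (\<Sum>k\<in>I. c k *\<^sub>R eval_vec q (z k))" by (rule eval_vec_spanning)
  have square: "0 \<le> (\<Sum>k\<in>I. c k * (eval (w i) (z k) * (eval r (z k))\<^sup>2))"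
    if r_mem: "r \<in> polys_le (d i)" for i r
  proof -
    obtain h where r: "r = (\<Sum>a | blk a = i. h a *\<^sub>R p a)"
      using ordered_basis_coordinates[OF p_basis[of i] finite r_mem] by blast
    \<comment> \<open>The coefficients of \<open>r\<close> are placed in block \<open>i\<close>
      alone, so that only the weight \<open>w i\<close> survives in the form.\<close>
    define \<rho> :: "real ^ 'l" where "\<rho> = (\<chi> a. if blk a = i then h a else 0)"
    have "(\<Sum>a | blk a = j. \<rho> $ a *\<^sub>R p a) = (if j = i then r else 0)" for j
      by (auto simp: \<rho>_def r intro!: sum.neutral)
    then have "(\<Sum>j\<in>UNIV. eval (w j) x * (block_vec j x \<bullet> \<rho>)\<^sup>2) = eval (w i) x * (eval r x)\<^sup>2" for x
      by (subst sum.remove[of _ i]) (auto simp: block_vec_inner)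
    then have "\<rho> \<bullet> (Lambda w q blk p y *v \<rho>) = (\<Sum>k\<in>I. c k * (eval (w i) (z k) * (eval r (z k))\<^sup>2))"
      by (simp add: y linear_sum[OF linear_Lambda] linear_cmul[OF linear_Lambda]
          sum_matrix_vector_mult inner_sum_right Lambda_eval_vec_quadratic_form
          flip: scaleR_matrix_vector_assoc)
    then show ?thesis using assms by (metis psd_def)
  qed
  have sos: "0 \<le> (\<Sum>k\<in>I. c k * (eval (w i) (z k) * eval \<sigma> (z k)))" if \<sigma>: "\<sigma> \<in> sos (d i)" for i \<sigma>
  proof -
    obtain rs where \<sigma>_eq: "\<sigma> = (\<Sum>r\<leftarrow>rs. r\<^sup>2)" and "set rs \<subseteq> polys_le (d i)"
      using \<sigma> by (auto simp: sos_def)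
    from this(2) show ?thesis
      unfolding \<sigma>_eq
    proof (induction rs)
      case (Cons r rs)
      then show ?case
        using square[of r i]
        by (simp add: eval_add eval_mult power2_eq_square distrib_left sum.distrib)
    qed simp
  qed
  have "0 \<le> x \<bullet> y" if x: "x \<in> Sig w d q" for x
  proof -
    obtain \<sigma> where \<sigma>: "(\<Sum>j\<in>UNIV. x $ j *\<^sub>R q j) = (\<Sum>i\<in>UNIV. w i * \<sigma> i)" "\<And>i. \<sigma> i \<in> sos (d i)"
      using x by (auto simp: Sig_def weighted_sos_def)
    have "x \<bullet> y = (\<Sum>k\<in>I. \<Sum>i\<in>UNIV. c k * (eval (w i) (z k) * eval (\<sigma> i) (z k)))"
      by (simp add: y inner_sum_right inner_eval_vec \<sigma>(1) eval_sum eval_mult sum_distrib_left)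
    also have "\<dots> = (\<Sum>i\<in>UNIV. \<Sum>k\<in>I. c k * (eval (w i) (z k) * eval (\<sigma> i) (z k)))"
      by (rule sum.swap)
    also have "\<dots> \<ge> 0" by (intro sum_nonneg sos \<sigma>)
    finally show ?thesis .
  qed
  then show ?thesis by (simp add: dual_cone_def)
qed

end

theorem theorem2p9:
  fixes w :: "'m::finite \<Rightarrow> 'n::finite rpoly" and d :: "'m \<Rightarrow> nat"
    and q :: "'u::finite \<Rightarrow> 'n rpoly"
    and blk :: "'l::finite \<Rightarrow> 'm" and p :: "'l \<Rightarrow> 'n rpoly"
    and s :: nat and z :: "nat \<Rightarrow> real ^ 'n" and \<alpha> :: "nat \<Rightarrow> real"
    and M :: "real ^ 'u ^ 'u" and e t :: "real ^ 'u" and U \<nu> :: nat and \<epsilon> :: real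
  assumes w_nonzero: "\<And>i. w i \<noteq> 0"
    and q_basis: "ordered_basis_on UNIV q (weighted_space w d)"
    and p_basis: "\<And>i. ordered_basis_on {a. blk a = i} p (polys_le (d i))"
    and Sig_closed: "closed (Sig w d q)"
    and Sig_pointed: "pointed (Sig w d q)"
    and U_def: "U = dim (weighted_space w d)"
    and \<nu>_def: "\<nu> = (\<Sum>i\<in>UNIV. dim (polys_le (d i) :: 'n rpoly set))"
    and z_mem: "z ` {1..s} \<subseteq> semialg w"
    and z_unisolvent: "unisolvent (z ` {1..s}) (weighted_space w d)"
    and \<alpha>_pos: "\<And>i. i \<in> {1..s} \<Longrightarrow> \<alpha> i > 0"
    and M_def: "M = (\<Sum>i=1..s. \<alpha> i *\<^sub>R outer (eval_vec q (z i)))"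
    and e_mem: "e \<in> interior (Sig w d q)"
    and t_mem: "t \<in> interior (Sig w d q)"
    and \<epsilon>_pos: "\<epsilon> > 0"
    and boundary: "t - \<epsilon> *\<^sub>R e \<in> frontier (Sig w d q)"
  shows "\<exists>y :: real ^ 'u. (\<forall>j. y $ j \<in> \<int>) \<and>
           dual_certificate w d q blk p y t \<and>
           infnorm y \<le> 1 / 2 + of_int \<lceil>3 / 2 * sqrt (real U * cond M) * norm t\<rceil>
                                * (real \<nu> / (k1 (Sig w d q) e * \<epsilon>))"
proof -
  interpret weighted_sos_data w d q blk p "{1..s}" z
    by standard (use w_nonzero q_basis p_basis z_mem z_unisolvent in auto)
  interpret log_det_barrier "Lambda w q blk p" "Sig w d q"
    by (rule log_det_barrier.intro)
      (use linear_Lambda symmetric_Lambda psd_Lambda_imp_dual t_mem in auto)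
  have U: "U = CARD('u)" using ordered_basis_dim[OF q_basis] by (simp add: U_def)
  \<comment> \<open>The fibres of \<open>blk\<close> partition the index type, so their sizes add up
    to its cardinality.\<close>
  have "\<nu> = (\<Sum>i\<in>UNIV. card {a. blk a = i})"
    unfolding \<nu>_def by (simp only: ordered_basis_dim[OF p_basis])
  also have "\<dots> = card (\<Union>i. {a. blk a = i})" by (rule card_UN_disjoint[symmetric]) auto
  also have "(\<Union>i. {a. blk a = i}) = UNIV" by auto
  finally have \<nu>: "\<nu> = CARD('l)" .
  \<comment> \<open>Closedness puts the boundary point into the cone, as needed to bound the
    maximiser.\<close>
  have "t - \<epsilon> *\<^sub>R e \<in> Sig w d q" using boundary Sig_closed frontier_subset_eq by blast
  moreover have "psd (Lambda w q blk p (eval_vec q (z i)))" if "i \<in> {1..s}" for i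
    using z_mem that by (intro psd_Lambda_eval_vec) auto
  moreover have "pd M" unfolding M_def using \<alpha>_pos by (rule pd_sum_outer_eval_vec)
  ultimately obtain y :: "real ^ 'u" where y: "\<forall>j. y $ j \<in> \<int>" "pd (Lambda w q blk p y)"
      "matrix_inv (hessian (\<lambda>x. - ln (det (Lambda w q blk p x))) y) *v t \<in> dual_cone (Sig w d q)"
      "infnorm y \<le> 1 / 2 + of_int \<lceil>3 / 2 * sqrt (real U * cond M) * norm t\<rceil>
        * (real \<nu> / (k1 (Sig w d q) e * \<epsilon>))"
    using integer_certificate_exists[OF t_mem e_mem _ \<epsilon>_pos pd_Lambda_sum_eval_vec _ \<alpha>_pos M_def]
    unfolding U \<nu> by blast
  have "barrier w q blk p = (\<lambda>x. - ln (det (Lambda w q blk p x)))"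
    by (simp add: fun_eq_iff barrier_def)
  then have "dual_certificate w d q blk p y t"
    using y(2,3) t_mem interior_subset pd_imp_interior_dual by (auto simp: dual_certificate_def)
  with y(1,4) show ?thesis by blast
qed

end
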